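(* Let $\alpha:\mathbb{R}\to\mathbb{R}$ be a regular locally doubling weight satisfying $\langle x\rangle^{-\kappa}\lesssim\alpha'(x)$ for some $\kappa<1$. Then there exist a meromorphic inner function $J$ and a positive integer $N_0$ such that $$|\alpha(x)-\arg J(x)|\le 2\pi\quad\text{for all }x\in\mathbb{R},$$ $$|J'(x)|\lesssim \alpha'(x)^{N_0}\langle x\rangle^{N_0}\quad\text{for all }x\in\mathbb{R},$$ and $$\langle\lambda\rangle^{-N_0}\alpha'(\lambda)^{-N_0}\lesssim |J'(\lambda)|\quad\text{for all }\lambda\in\Lambda,$$ where $\Lambda=\{\lambda\in\mathbb{R}:\alpha(\lambda)=0 \bmod 2\pi\}$.
   Context: Notation: $\langle x\rangle=(1+x^2)^{1/2}$; for nonnegative functions $f,g$, $f\lesssim g$ means there is a constant $C>0$, independent of the variable, with $f\le Cg$. For strictly increasing $\alpha$, $d_\alpha(x,y)=|\alpha(x)-\alpha(y)|$. A smooth strictly increasing map $\alpha:\mathbb{R}\to\mathbb{R}$ is a regular locally doubling weight if: (i) there are constants $M,m>0$ and $R>0$ with $m\alpha'(y)\le\alpha'(x)\le M\alpha'(y)$ for all $x,y\in\mathbb{R}$ with $d_\alpha(x,y)\le1$ and $|x|,|y|\ge R$; and (ii) there are constants $C>0$ and $R>0$ with $|\alpha''(x)|\le C\alpha'(x)^2$ for $|x|\ge R$. An inner function is a holomorphic map $\Theta:\mathbb{C}_+\to\mathbb{D}$ from the upper half-plane to the unit disc with $\lim_{y\to0^+}|\Theta(x+iy)|=1$ for almost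 every $x\in\mathbb{R}$. It is a meromorphic inner function if it extends to a meromorphic function on $\mathbb{C}$; then it is analytic and unimodular on $\mathbb{R}$. Throughout, meromorphic inner functions are normalized (by a unimodular factor) so that $\Theta(0)=1$, and $\arg\Theta:\mathbb{R}\to\mathbb{R}$ denotes the unique continuous function with $\Theta(x)=e^{i\arg\Theta(x)}$ for $x\in\mathbb{R}$ and $\arg\Theta(0)=0$; it is real-analytic and increasing.
   Formalization: Since arg J(0)=0, the first bound fails when |α(0)|>2π (e.g. α(x)=x+100); it is proved as |α(x)−arg J(x)−2πk|≤2π for all x, with one integer k depending on α, and k=0 is guaranteed when |α(0)|≤π. *)

theory Defs
  imports "HOL-Complex_Analysis.Complex_Analysis"
begin

definition smooth :: "(real \<Rightarrow> real) \<Rightarrow> bool" where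
  "smooth f \<longleftrightarrow> (\<forall>n. (deriv ^^ n) f differentiable_on UNIV)"

definition japanese_bracket :: "real \<Rightarrow> real"  (\<open>\<langle>_\<rangle>\<close>) where
  "\<langle>x\<rangle> = sqrt (1 + x\<^sup>2)"

definition weight_dist :: "(real \<Rightarrow> real) \<Rightarrow> real \<Rightarrow> real \<Rightarrow> real" where
  "weight_dist \<alpha> x y = \<bar>\<alpha> x - \<alpha> y\<bar>"

definition regular_locally_doubling_weight :: "(real \<Rightarrow> real) \<Rightarrow> bool" where
  "regular_locally_doubling_weight \<alpha> \<longleftrightarrow>
     smooth \<alpha> \<and> strict_mono \<alpha> \<and>
     (\<exists>M>0. \<exists>m>0. \<exists>R>0. \<forall>x y. weight_dist \<alpha> x y \<le> 1 \<and> \<bar>x\<bar> \<ge> R \<and> \<bar>y\<bar> \<ge> R \<longrightarrow>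
        m * deriv \<alpha> y \<le> deriv \<alpha> x \<and> deriv \<alpha> x \<le> M * deriv \<alpha> y) \<and>
     (\<exists>C>0. \<exists>R>0. \<forall>x. \<bar>x\<bar> \<ge> R \<longrightarrow> \<bar>deriv (deriv \<alpha>) x\<bar> \<le> C * (deriv \<alpha> x)\<^sup>2)"

definition lesssim_on :: "'a set \<Rightarrow> ('a \<Rightarrow> real) \<Rightarrow> ('a \<Rightarrow> real) \<Rightarrow> bool" where
  "lesssim_on S f g \<longleftrightarrow> (\<exists>C>0. \<forall>x\<in>S. f x \<le> C * g x)"

text \<open>The boundary limits are radial limits from above; only the values of \<open>\<Theta>\<close> in the open
  upper half-plane matter.\<close>

definition inner_function :: "(complex \<Rightarrow> complex) \<Rightarrow> bool" where
  "inner_function \<Theta> \<longleftrightarrow>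
     \<Theta> holomorphic_on {z. Im z > 0} \<and>
     \<Theta> ` {z. Im z > 0} \<subseteq> ball 0 1 \<and>
     (AE x in lborel. ((\<lambda>y. norm (\<Theta> (Complex x y))) \<longlongrightarrow> 1) (at_right 0))"

text \<open>A meromorphic inner function is identified with its meromorphic extension to the plane.
  The predicate \<open>nicely_meromorphic_on\<close> (rather than \<open>meromorphic_on\<close>) excludes removable
  singularities, so that the values and derivatives on the real line are those of the analytic
  function.\<close>

definition meromorphic_inner_function :: "(complex \<Rightarrow> complex) \<Rightarrow> bool" where
  "meromorphic_inner_function \<Theta> \<longleftrightarrow> inner_function \<Theta> \<and> \<Theta> nicely_meromorphic_on UNIV"

text \<open>The continuous argument along the real line, vanishing at the origin; it is meaningful if
  \<open>\<Theta>\<close> is continuous and unimodular on the real line with \<open>\<Theta> 0 = 1\<close>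
  (see \<open>ex1_real_arg\<close>).\<close>

definition real_arg :: "(complex \<Rightarrow> complex) \<Rightarrow> real \<Rightarrow> real" where
  "real_arg \<Theta> = (THE \<phi>. continuous_on UNIV \<phi> \<and> \<phi> 0 = 0 \<and> (\<forall>x. \<Theta> (of_real x) = cis (\<phi> x)))"

lemma ex1_real_arg:
  fixes \<Theta> :: "complex \<Rightarrow> complex"
  assumes cont: "continuous_on UNIV (\<lambda>x::real. \<Theta> (of_real x))"
    and unimod: "\<And>x::real. norm (\<Theta> (of_real x)) = 1" and zero: "\<Theta> 0 = 1"
  shows "\<exists>!\<phi>. continuous_on UNIV \<phi> \<and> \<phi> 0 = 0 \<and> (\<forall>x. \<Theta> (of_real x) = cis (\<phi> x))"
proof (rule ex_ex1I)
  have nz: "\<Theta> (of_real x) \<noteq> 0" for x :: real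
    using unimod[of x] by auto
  obtain g where g: "continuous_on UNIV g" "\<And>x::real. \<Theta> (of_real x) = exp (g x)"
    using continuous_logarithm_on_contractible[OF cont convex_imp_contractible] nz by auto
  have Re0: "Re (g x) = 0" for x
    using unimod[of x] g(2)[of x] by simp
  have ecis: "exp (g x) = cis (Im (g x))" for x
    using Re0[of x] by (simp add: exp_eq_polar)
  have "cis (Im (g 0)) = 1"
    using g(2)[of 0] zero ecis[of 0] by simp
  then have "\<Theta> (of_real x) = cis (Im (g x) - Im (g 0))" for x
    using g(2)[of x] ecis[of x] by (simp flip: cis_divide)
  moreover have "continuous_on UNIV (\<lambda>x. Im (g x) - Im (g 0))"
    by (intro continuous_intros g)
  ultimately show "\<exists>\<phi>. continuous_on UNIV \<phi> \<and> \<phi> 0 = 0 \<and> (\<forall>x. \<Theta> (of_real x) = cis (\<phi> x))"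
    by (intro exI[of _ "\<lambda>x. Im (g x) - Im (g 0)"]) auto
next
  fix \<phi> \<psi> :: "real \<Rightarrow> real"
  assume \<phi>: "continuous_on UNIV \<phi> \<and> \<phi> 0 = 0 \<and> (\<forall>x. \<Theta> (of_real x) = cis (\<phi> x))"
    and \<psi>: "continuous_on UNIV \<psi> \<and> \<psi> 0 = 0 \<and> (\<forall>x. \<Theta> (of_real x) = cis (\<psi> x))"
  define d where "d x = (\<phi> x - \<psi> x) / (2 * pi)" for x
  have "d x \<in> \<int>" for x
  proof -
    have "cis (\<phi> x - \<psi> x) = 1"
      using \<phi> \<psi> cis_neq_zero by (metis cis_divide divide_self)
    then obtain n :: int where "\<phi> x - \<psi> x = 2 * pi * n"
      by (auto simp: complex_eq_iff cos_one_2pi_int mult_ac)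
    then show ?thesis by (simp add: d_def)
  qed
  moreover have "continuous_on UNIV d"
    unfolding d_def using \<phi> \<psi> by (intro continuous_intros) auto
  ultimately have "d constant_on UNIV"
    by (intro continuous_discrete_range_constant)
       (auto intro!: exI[of _ 1] simp: Ints_nonzero_abs_ge1)
  then have "d x = d 0" for x
    by (auto simp: constant_on_def)
  then show "\<phi> = \<psi>"
    using \<phi> \<psi> by (auto simp: d_def fun_eq_iff)
qed

end

theory Submission
  imports Defs
begin

text \<open>The function \<open>J = (F - \<i>) / (F + \<i>)\<close> is a meromorphic inner function for every
  \<open>F z = b + (\<Sum>k. \<mu> k / (a k - z))\<close> with positive summable masses; it equals \<open>1\<close> exactly at the nodes
  \<open>a k\<close>, with \<open>\<bar>J' (a k)\<bar> = 2 / \<mu> k\<close>, and its argument increases by \<open>2\<pi>\<close> between consecutive nodes.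
  Placing the nodes where \<open>\<alpha>\<close> is a multiple of \<open>2\<pi>\<close> therefore keeps \<open>arg J\<close> within \<open>2\<pi>\<close> of \<open>\<alpha>\<close>
  whatever the masses are, so these may be chosen summable but only polynomially small.
  Splitting off the node nearest to \<open>x\<close>, \<open>F z = m / (a n - z) + G z\<close>, the derivative of \<open>J\<close> at \<open>x\<close>
  has modulus \<open>2 \<bar>m + u\<^sup>2 G'\<bar> / ((m + u G)\<^sup>2 + u\<^sup>2)\<close> where \<open>u = a n - x\<close>,
  which is at most \<open>8 (1 + \<bar>G\<bar>)\<^sup>2 / m + 2 \<bar>G'\<bar>\<close>. The other nodes have distance at least a constant over
  \<open>deriv \<alpha> x\<close> from \<open>x\<close>, because \<open>ln (deriv \<alpha>)\<close> is Lipschitz with respect to \<open>weight_dist \<alpha>\<close>, so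
  \<open>G\<close> and \<open>G'\<close> are polynomially bounded. The assumption \<open>\<kappa> < 1\<close> makes \<open>\<langle>x\<rangle>\<close> bounded by a power of
  \<open>deriv \<alpha> x * \<langle>x\<rangle>\<close>.\<close>

section \<open>Inner functions from discrete measures\<close>

locale clark =
  fixes a \<mu> :: "int \<Rightarrow> real" and b :: real
  assumes mono: "strict_mono a"
    and pos: "\<And>k. \<mu> k > 0"
    and summable: "\<mu> summable_on UNIV"
    and isolated: "\<And>x::real. \<exists>n. \<exists>e>0. \<forall>k. k \<noteq> n \<longrightarrow> e \<le> \<bar>a k - x\<bar>"
begin

text \<open>At a node the corresponding summand is \<open>\<mu> k / 0 = 0\<close>, so \<open>F\<close> takes a finite junk value there;
  \<open>J\<close> is still correct because \<open>remove_sings\<close> only depends on punctured neighbourhoods.\<close>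

definition S :: "int set \<Rightarrow> complex \<Rightarrow> complex" where
  "S A z = (\<Sum>\<^sub>\<infinity>k\<in>A. of_real (\<mu> k) / (of_real (a k) - z))"

definition F :: "complex \<Rightarrow> complex" where
  "F z = of_real b + S UNIV z"

definition G :: "int \<Rightarrow> complex \<Rightarrow> complex" where
  "G n z = of_real b + S (-{n}) z"

definition J :: "complex \<Rightarrow> complex" where
  "J = remove_sings (\<lambda>z. (F z - \<i>) / (F z + \<i>))"

definition mass :: real where "mass = (\<Sum>\<^sub>\<infinity>k. \<mu> k)"

lemma mass_nonneg: "mass \<ge> 0"
  unfolding mass_def by (intro infsum_nonneg) (simp add: pos less_imp_le)

lemma masses_summable_on: "\<mu> summable_on A"
  using summable by (rule summable_on_subset_banach) auto

lemma infsum_le_mass: "infsum \<mu> A \<le> mass"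
  unfolding mass_def by (intro infsum_mono2 masses_summable_on) (auto simp: pos less_imp_le)

lemma norm_term_le:
  fixes z :: complex
  assumes "e > 0" "e \<le> norm (of_real (a k) - z)"
  shows "norm (of_real (\<mu> k) / (of_real (a k) - z)) \<le> \<mu> k / e"
proof -
  have "norm (of_real (\<mu> k) / (of_real (a k) - z)) = \<mu> k / norm (of_real (a k) - z)"
    using pos[of k] by (simp add: norm_divide)
  also have "\<dots> \<le> \<mu> k / e"
    using assms pos[of k] by (intro divide_left_mono mult_pos_pos) linarith+
  finally show ?thesis .
qed

lemma abs_summable_terms:
  fixes z :: complex
  assumes "e > 0" "\<And>k. k \<in> A \<Longrightarrow> e \<le> norm (of_real (a k) - z)"
  shows "(\<lambda>k. norm (of_real (\<mu> k) / (of_real (a k) - z))) summable_on A"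
proof (rule Infinite_Sum.abs_summable_on_comparison_test)
  show "(\<lambda>k. norm (\<mu> k / e)) summable_on A"
    using summable_on_cmult_left[OF masses_summable_on[of A], of "1/e"] pos \<open>e > 0\<close>
    by (simp add: less_imp_le field_simps)
qed (use norm_term_le[OF assms(1) assms(2)] pos \<open>e > 0\<close> in \<open>auto simp: less_imp_le\<close>)

lemma norm_S_le:
  assumes "e > 0" "\<And>k. k \<in> A \<Longrightarrow> e \<le> norm (of_real (a k) - z)"
  shows "norm (S A z) \<le> mass / e"
proof -
  have "norm (S A z) \<le> (\<Sum>\<^sub>\<infinity>k\<in>A. norm (of_real (\<mu> k) / (of_real (a k) - z)))"
    unfolding S_def by (rule norm_infsum_bound[OF abs_summable_terms[OF assms]])
  also have "\<dots> \<le> (\<Sum>\<^sub>\<infinity>k\<in>A. \<mu> k * (1/e))"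
    by (intro infsum_mono abs_summable_terms[OF assms] summable_on_cmult_left masses_summable_on)
       (use norm_term_le[OF assms(1) assms(2)] in auto)
  also have "\<dots> = infsum \<mu> A * (1/e)"
    by (rule infsum_cmult_left') 
  also have "\<dots> \<le> mass / e"
    using infsum_le_mass[of A] \<open>e > 0\<close> by (simp add: divide_right_mono)
  finally show ?thesis .
qed

lemma norm_diff_ge_half:
  fixes z w :: complex
  assumes "e \<le> norm (c - z)" "w \<in> cball z (e/2)"
  shows "e/2 \<le> norm (c - w)"
  using assms norm_triangle_sub[of "c - z" "c - w"] by (auto simp: dist_norm norm_minus_commute)

lemma holomorphic_S:
  assumes e: "e > 0" "\<And>k. k \<in> A \<Longrightarrow> e \<le> norm (of_real (a k) - z)"
  shows "S A holomorphic_on ball z (e/2)"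
proof -
  have far: "e/2 \<le> norm (of_real (a k) - w)" if "k \<in> A" "w \<in> cball z (e/2)" for k w
    using norm_diff_ge_half[OF e(2)] that by auto
  have ne: "of_real (a k) - w \<noteq> 0" if "k \<in> A" "w \<in> cball z (e/2)" for k w
    using far[OF that] e(1) by auto
  have ul: "uniform_limit (cball z (e/2)) (\<lambda>X w. \<Sum>k\<in>X. of_real (\<mu> k) / (of_real (a k) - w))
          (\<lambda>w. \<Sum>\<^sub>\<infinity>k\<in>A. of_real (\<mu> k) / (of_real (a k) - w)) (finite_subsets_at_top A)"
    by (rule Weierstrass_m_test_general[of _ _ _ "\<lambda>k. \<mu> k * (1/(e/2))"])
       (use norm_term_le[OF _ far] e(1) summable_on_cmult_left[OF masses_summable_on[of A], of "2/e"] in auto)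
  have "eventually (\<lambda>X. continuous_on (cball z (e/2)) (\<lambda>w. \<Sum>k\<in>X. of_real (\<mu> k) / (of_real (a k) - w))
      \<and> (\<lambda>w. \<Sum>k\<in>X. of_real (\<mu> k) / (of_real (a k) - w)) holomorphic_on ball z (e/2))
      (finite_subsets_at_top A)"
    by (rule eventually_finite_subsets_at_top_weakI)
       (use ne in \<open>auto intro!: continuous_intros holomorphic_intros simp: subset_iff\<close>)
  from holomorphic_uniform_limit[OF this ul] show ?thesis
    unfolding S_def[abs_def] by (simp add: finite_subsets_at_top_neq_bot)
qed

lemma analytic_S:
  assumes "e > 0" "\<And>k. k \<in> A \<Longrightarrow> e \<le> norm (of_real (a k) - z)"
  shows "S A analytic_on {z}"
  using holomorphic_S[OF assms] assms(1) analytic_at by (meson centre_in_ball half_gt_zero open_ball)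

lemma norm_deriv_S_le:
  assumes e: "e > 0" "\<And>k. k \<in> A \<Longrightarrow> e \<le> norm (of_real (a k) - z)"
  shows "norm (deriv (S A) z) \<le> 8 * mass / e\<^sup>2"
proof -
  have hol: "S A holomorphic_on ball z (e/2)" by (rule holomorphic_S[OF e])
  have sub: "cball z (e/4) \<subseteq> ball z (e/2)" "ball z (e/4) \<subseteq> ball z (e/2)" using e(1) by auto
  have "norm ((deriv ^^ 1) (S A) z) \<le> fact 1 * (mass / (e/2)) / (e/4) ^ 1"
  proof (rule Cauchy_inequality)
    show "S A holomorphic_on ball z (e/4)" "continuous_on (cball z (e/4)) (S A)"
      using holomorphic_on_subset[OF hol] holomorphic_on_imp_continuous_on[OF hol] sub
        continuous_on_subset by blast+
    fix x assume "norm (z - x) = e/4"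
    then show "norm (S A x) \<le> mass / (e/2)"
      by (intro norm_S_le norm_diff_ge_half[OF e(2)]) (use e(1) in \<open>auto simp: dist_norm\<close>)
  qed (use e in auto)
  then show ?thesis by (simp add: power2_eq_square field_simps)
qed

text \<open>No node other than possibly \<open>a n\<close> lies at \<open>z\<close>; whether \<open>a n\<close> does is left open.\<close>

definition near :: "int \<Rightarrow> complex \<Rightarrow> bool" where
  "near n z \<longleftrightarrow> (\<exists>e>0. \<forall>k. k \<noteq> n \<longrightarrow> e \<le> norm (of_real (a k) - z))"

lemma near_ex: "\<exists>n. near n z"
proof -
  obtain n e where "e > 0" "\<And>k. k \<noteq> n \<Longrightarrow> e \<le> \<bar>a k - Re z\<bar>"
    using isolated[of "Re z"] by blast
  moreover have "\<bar>a k - Re z\<bar> \<le> norm (of_real (a k) - z)" for k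
    using abs_Re_le_cmod[of "of_real (a k) - z"] by simp
  ultimately show ?thesis unfolding near_def by (meson order_trans)
qed

lemma near_node: "near n (of_real (a n))"
proof -
  obtain m where m: "near m (of_real (a n))" using near_ex by blast
  then have "m = n" unfolding near_def by fastforce
  with m show ?thesis by simp
qed

lemma analytic_G: "near n z \<Longrightarrow> G n analytic_on {z}"
  unfolding near_def G_def[abs_def]
  by (intro analytic_intros) (auto intro!: analytic_S)

lemma summable_terms:
  fixes z :: complex
  shows "(\<lambda>k. of_real (\<mu> k) / (of_real (a k) - z)) summable_on A"
proof -
  obtain n e where e: "e>0" "\<And>k. k \<noteq> n \<Longrightarrow> e \<le> norm (of_real (a k) - z)"
    using near_ex[of z] unfolding near_def by blast
  have "(\<lambda>k. of_real (\<mu> k) / (of_real (a k) - z :: complex)) summable_on (-{n})"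
    by (rule abs_summable_summable, rule abs_summable_terms[OF e(1)]) (use e(2) in auto)
  then have "(\<lambda>k. of_real (\<mu> k) / (of_real (a k) - z)) summable_on (-{n} \<union> {n})"
    by (intro summable_on_Un_disjoint) auto
  then show ?thesis by (rule summable_on_subset_banach) auto
qed

lemma F_eq: "F z = of_real (\<mu> n) / (of_real (a n) - z) + G n z"
proof -
  have "S (-{n} \<union> {n}) z = S (-{n}) z + S {n} z"
    unfolding S_def by (rule infsum_Un_disjoint) (auto intro: summable_terms)
  then show ?thesis unfolding F_def G_def by (simp add: S_def Un_commute)
qed

lemma summable_terms_real: "(\<lambda>k. \<mu> k / (a k - x)) summable_on A"
proof -
  have "(\<lambda>k. Re (of_real (\<mu> k) / (of_real (a k) - of_real x))) summable_on A"
    by (rule summable_on_Re[OF summable_terms])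
  moreover have "Re (of_real (\<mu> k) / (of_real (a k) - of_real x)) = \<mu> k / (a k - x)" for k
    by (metis Re_complex_of_real of_real_diff of_real_divide)
  ultimately show ?thesis by simp
qed

lemma S_of_real: "S A (of_real x) = of_real (\<Sum>\<^sub>\<infinity>k\<in>A. \<mu> k / (a k - x))"
proof -
  have "S A (of_real x) = (\<Sum>\<^sub>\<infinity>k\<in>A. of_real (\<mu> k / (a k - x)))"
    unfolding S_def by simp
  also have "\<dots> = of_real (\<Sum>\<^sub>\<infinity>k\<in>A. \<mu> k / (a k - x))"
    by (rule infsumI, rule has_sum_of_real, rule has_sum_infsum, rule summable_terms_real)
  finally show ?thesis .
qed

lemma Im_term_pos:
  assumes "Im z > 0" shows "Im (of_real (\<mu> k) / (of_real (a k) - z)) > 0"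
  using pos[of k] assms unfolding Im_divide by (auto intro!: divide_pos_pos add_nonneg_pos)

lemma has_sum_Im_S:
  "((\<lambda>k. Im (of_real (\<mu> k) / (of_real (a k) - z))) has_sum Im (S A z)) A"
  unfolding S_def by (intro has_sum_Im has_sum_infsum summable_terms)

lemma Im_F_pos:
  assumes "Im z > 0" shows "Im (F z) > 0"
proof -
  have "0 < Im (S UNIV z)"
    by (rule has_sum_strict_mono[OF has_sum_0 has_sum_Im_S, of _ "\<lambda>_. 0" _ 0])
       (use Im_term_pos[OF assms] in \<open>auto simp: less_imp_le\<close>)
  then show ?thesis unfolding F_def by simp
qed

lemma Im_G_nonneg:
  assumes "Im z > 0" shows "Im (G n z) \<ge> 0"
  using has_sum_nonneg[OF has_sum_Im_S] Im_term_pos[OF assms]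
  unfolding G_def by (force simp: less_imp_le)

lemma Im_F_real: "Im (F (of_real x)) = 0" and Im_G_real: "Im (G n (of_real x)) = 0"
  unfolding F_def G_def by (simp_all add: S_of_real)

text \<open>Clearing the pole at \<open>a n\<close> exhibits the Cayley transform of \<open>F\<close> as a quotient of functions that
  are analytic at \<open>a n\<close>, with denominator \<open>\<mu> n\<close> there.\<close>

definition num :: "int \<Rightarrow> complex \<Rightarrow> complex" where
  "num n z = of_real (\<mu> n) + (of_real (a n) - z) * (G n z - \<i>)"

definition den :: "int \<Rightarrow> complex \<Rightarrow> complex" where
  "den n z = of_real (\<mu> n) + (of_real (a n) - z) * (G n z + \<i>)"

lemma cayley_eq:
  assumes "z \<noteq> of_real (a n)"
  shows "(F z - \<i>) / (F z + \<i>) = num n z / den n z"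
proof -
  define u where "u = of_real (a n) - z"
  have u: "u \<noteq> 0" using assms by (simp add: u_def)
  have "F z - \<i> = num n z / u" "F z + \<i> = den n z / u"
    using u unfolding F_eq[of z n] num_def den_def u_def[symmetric] by (simp_all add: field_simps)
  then show ?thesis using u by simp
qed

lemma J_eq_remove_sings: "J = remove_sings (\<lambda>z. num n z / den n z)"
proof
  fix z :: complex
  have "eventually (\<lambda>w. w \<noteq> of_real (a n)) (at z)"
    by (rule eventually_neq_at_within)
  then have "eventually (\<lambda>w. (F w - \<i>) / (F w + \<i>) = num n w / den n w) (at z)"
    by eventually_elim (rule cayley_eq)
  then show "J z = remove_sings (\<lambda>z. num n z / den n z) z"
    unfolding J_def by (rule remove_sings_cong) simp
qed

lemma den_nonzero:
  assumes "Im z \<ge> 0" shows "den n z \<noteq> 0"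
proof (cases "Im z = 0")
  case True
  then have z: "z = of_real (Re z)" by (simp add: complex_eq_iff)
  have "Im (den n z) = a n - Re z"
    using Im_G_real[of n "Re z"] unfolding den_def z[symmetric] by (simp add: True)
  moreover have "den n z = of_real (\<mu> n)" if "a n = Re z"
    unfolding den_def using that z by simp
  ultimately show ?thesis using pos[of n] by fastforce
next
  case False
  with assms have "Im z > 0" by simp
  then have "z \<noteq> of_real (a n)" by auto
  moreover have "F z + \<i> \<noteq> 0"
    using Im_F_pos[OF \<open>Im z > 0\<close>] by (auto simp: complex_eq_iff)
  ultimately show ?thesis
    unfolding den_def F_eq[of z n] by (auto simp: field_simps)
qed

lemma analytic_num [analytic_intros]: "near n z \<Longrightarrow> num n analytic_on {z}"
  and analytic_den [analytic_intros]: "near n z \<Longrightarrow> den n analytic_on {z}"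
  unfolding num_def[abs_def] den_def[abs_def] by (intro analytic_intros analytic_G; simp)+

lemma J_locally:
  assumes "near n z" "Im z \<ge> 0"
  shows "eventually (\<lambda>w. J w = num n w / den n w) (nhds z)"
  unfolding J_eq_remove_sings[of n]
  by (intro eventually_remove_sings_eq_nhds analytic_intros assms) (use den_nonzero assms in auto)

lemma J_at: "near n z \<Longrightarrow> Im z \<ge> 0 \<Longrightarrow> J z = num n z / den n z"
  using J_locally eventually_nhds_x_imp_x by blast

lemma analytic_J:
  assumes "Im z \<ge> 0" shows "J analytic_on {z}"
proof -
  obtain n where n: "near n z" using near_ex by blast
  have "(\<lambda>w. num n w / den n w) analytic_on {z}"
    by (intro analytic_intros n) (use den_nonzero assms in auto)
  then show ?thesis unfolding J_eq_remove_sings[of n] by (rule remove_sings_analytic_on)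
qed

lemma J_eq_cayley:
  assumes "Im z \<ge> 0" "\<And>n. z \<noteq> of_real (a n)"
  shows "J z = (F z - \<i>) / (F z + \<i>)"
proof -
  obtain n where n: "near n z" using near_ex by blast
  show ?thesis using J_at[OF n assms(1)] cayley_eq[of z n] assms(2) by auto
qed

lemma J_node: "J (of_real (a n)) = 1"
  using J_at[OF near_node[of n]] pos[of n] by (simp add: num_def den_def)

lemma meromorphic_F: "F meromorphic_on UNIV"
proof -
  have "F meromorphic_on {z}" for z
  proof -
    obtain n where n: "near n z" using near_ex by blast
    have "(\<lambda>z. of_real (\<mu> n) / (of_real (a n) - z) + G n z) meromorphic_on {z}"
      by (intro meromorphic_intros analytic_on_imp_meromorphic_on[OF analytic_G[OF n]])
    then show ?thesis using F_eq[of _ n] by (simp add: F_eq[of _ n, abs_def])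
  qed
  then show ?thesis unfolding meromorphic_on_def by blast
qed

lemma nicely_meromorphic_J: "J nicely_meromorphic_on UNIV"
  unfolding J_def by (intro remove_sings_nicely_meromorphic meromorphic_intros meromorphic_F)

lemma norm_J_less:
  assumes "Im z > 0" shows "norm (J z) < 1"
proof -
  have "J z = (F z - \<i>) / (F z + \<i>)" using assms by (intro J_eq_cayley) auto
  moreover have "norm (F z - \<i>) < norm (F z + \<i>)"
    unfolding cmod_def using Im_F_pos[OF assms]
    by (intro real_sqrt_less_mono) (simp add: power2_eq_square algebra_simps)
  moreover from this have "norm (F z + \<i>) > 0" by (meson norm_ge_zero order_le_less_trans)
  ultimately show ?thesis by (simp add: norm_divide)
qed

definition f :: "real \<Rightarrow> real" where "f x = Re (F (of_real x))"

lemma F_real: "F (of_real x) = of_real (f x)"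
  by (simp add: f_def Im_F_real complex_eq_iff)

lemma J_real:
  assumes "x \<notin> range a"
  shows "Re (J (of_real x)) = ((f x)\<^sup>2 - 1) / ((f x)\<^sup>2 + 1)"
    and "Im (J (of_real x)) = - 2 * f x / ((f x)\<^sup>2 + 1)"
proof -
  have J: "J (of_real x) = (of_real (f x) - \<i>) / (of_real (f x) + \<i>)"
    using J_eq_cayley[of "of_real x"] assms by (auto simp: F_real)
  show "Re (J (of_real x)) = ((f x)\<^sup>2 - 1) / ((f x)\<^sup>2 + 1)"
    "Im (J (of_real x)) = - 2 * f x / ((f x)\<^sup>2 + 1)"
    unfolding J by (simp_all add: Re_divide Im_divide power2_eq_square)
qed

lemma norm_J_real: "norm (J (of_real x)) = 1"
proof (cases "x \<in> range a")
  case True then show ?thesis by (auto simp: J_node)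
next
  case False
  have J: "J (of_real x) = (of_real (f x) - \<i>) / (of_real (f x) + \<i>)"
    using J_eq_cayley[of "of_real x"] False by (auto simp: F_real)
  have "norm (of_real (f x) - \<i>) = norm (of_real (f x) + \<i>)" "of_real (f x) + \<i> \<noteq> 0"
    by (simp_all add: cmod_def complex_eq_iff)
  then show ?thesis unfolding J by (simp add: norm_divide)
qed

lemma J_eq_1_iff: "J (of_real x) = 1 \<longleftrightarrow> x \<in> range a"
proof
  assume J: "J (of_real x) = 1"
  show "x \<in> range a"
  proof (rule ccontr)
    assume "x \<notin> range a"
    from J_real(1)[OF this] J have "((f x)\<^sup>2 - 1) / ((f x)\<^sup>2 + 1) = 1" by simp
    moreover have "(f x)\<^sup>2 + 1 > 0" by (simp add: add_nonneg_pos)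
    ultimately show False by (simp add: field_simps)
  qed
qed (auto simp: J_node)

lemma continuous_J_real: "continuous_on UNIV (\<lambda>x::real. J (of_real x))"
proof -
  have "isCont (\<lambda>x::real. J (of_real x)) x" for x
    by (rule isCont_o2[of _ of_real]) (auto intro!: analytic_at_imp_isCont analytic_J)
  then show ?thesis by (simp add: continuous_at_imp_continuous_on)
qed

lemma meromorphic_inner_J: "meromorphic_inner_function J"
proof -
  have "((\<lambda>y. norm (J (Complex x y))) \<longlongrightarrow> 1) (at_right 0)" for x
  proof -
    have "isCont J (of_real x)" by (intro analytic_at_imp_isCont analytic_J) simp
    moreover have "((\<lambda>y. Complex x y) \<longlongrightarrow> of_real x) (at_right 0)"
      unfolding complex_of_real_def by (intro tendsto_intros)
    ultimately have "((\<lambda>y. J (Complex x y)) \<longlongrightarrow> J (of_real x)) (at_right 0)"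
      by (rule isCont_tendsto_compose)
    from tendsto_norm[OF this] show ?thesis by (simp add: norm_J_real)
  qed
  moreover have "J holomorphic_on {z. Im z > 0}"
    by (rule analytic_imp_holomorphic) (use analytic_J in \<open>auto simp: analytic_on_analytic_at[of J "{z. _ z}"]\<close>)
  ultimately show ?thesis
    unfolding meromorphic_inner_function_def inner_function_def
    using nicely_meromorphic_J norm_J_less by auto
qed

lemma deriv_J:
  fixes x :: real
  assumes "near n (of_real x)"
  defines "u \<equiv> of_real (a n) - of_real x"
  shows "deriv J (of_real x) = 2 * \<i> * (of_real (\<mu> n) + u\<^sup>2 * deriv (G n) (of_real x)) / (den n (of_real x))\<^sup>2"
proof -
  let ?z = "of_real x :: complex"
  have G: "(G n has_field_derivative deriv (G n) ?z) (at ?z)"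
    using analytic_G[OF assms(1)] by (simp add: DERIV_deriv_iff_field_differentiable analytic_on_imp_differentiable_at)
  have dz: "den n ?z \<noteq> 0" by (rule den_nonzero) simp
  have 1: "(num n has_field_derivative - (G n ?z - \<i>) + u * deriv (G n) ?z) (at ?z)"
    unfolding num_def[abs_def] u_def by (auto intro!: derivative_eq_intros G)
  have 2: "(den n has_field_derivative - (G n ?z + \<i>) + u * deriv (G n) ?z) (at ?z)"
    unfolding den_def[abs_def] u_def by (auto intro!: derivative_eq_intros G)
  have "deriv J ?z = deriv (\<lambda>w. num n w / den n w) ?z"
    by (intro deriv_cong_ev J_locally assms(1)) auto
  also have "\<dots> = ((- (G n ?z - \<i>) + u * deriv (G n) ?z) * den n ?z
      - num n ?z * (- (G n ?z + \<i>) + u * deriv (G n) ?z)) / (den n ?z * den n ?z)"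
    by (intro DERIV_imp_deriv DERIV_divide 1 2 dz)
  also have "(- (G n ?z - \<i>) + u * deriv (G n) ?z) * den n ?z
      - num n ?z * (- (G n ?z + \<i>) + u * deriv (G n) ?z)
      = 2 * \<i> * (of_real (\<mu> n) + u\<^sup>2 * deriv (G n) ?z)"
    unfolding num_def den_def u_def[symmetric] by (simp add: algebra_simps power2_eq_square)
  finally show ?thesis by (simp add: power2_eq_square)
qed

lemma norm_den_sq:
  "(norm (den n (of_real x)))\<^sup>2 = (\<mu> n + (a n - x) * Re (G n (of_real x)))\<^sup>2 + (a n - x)\<^sup>2"
  using Im_G_real[of n x] by (simp add: cmod_power2 den_def)

lemma norm_deriv_J:
  assumes "near n (of_real x)"
  shows "norm (deriv J (of_real x)) =
     2 * norm (of_real (\<mu> n) + of_real ((a n - x)\<^sup>2) * deriv (G n) (of_real x)) /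
     ((\<mu> n + (a n - x) * Re (G n (of_real x)))\<^sup>2 + (a n - x)\<^sup>2)"
  unfolding deriv_J[OF assms] norm_den_sq[symmetric]
  by (simp add: norm_mult norm_divide norm_power)

lemma norm_deriv_J_node: "norm (deriv J (of_real (a n))) = 2 / \<mu> n"
  using pos[of n] by (simp add: norm_deriv_J[OF near_node] power2_eq_square)

text \<open>The derivative is computed along the imaginary direction, where \<open>Im (G n) \<ge> 0\<close>.\<close>

lemma Re_deriv_G_nonneg:
  assumes "near n (of_real x)"
  shows "Re (deriv (G n) (of_real x)) \<ge> 0"
proof -
  let ?z = "of_real x :: complex"
  have G: "(G n has_field_derivative deriv (G n) ?z) (at ?z)"
    using analytic_G[OF assms(1)] by (simp add: DERIV_deriv_iff_field_differentiable analytic_on_imp_differentiable_at)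
  have lim: "filterlim (\<lambda>y. \<i> * of_real y) (at 0) (at_right (0::real))"
    by (auto simp: filterlim_at eventually_at_filter intro!: tendsto_eq_intros)
  have "((\<lambda>y. (G n (?z + \<i> * of_real y) - G n ?z) / (\<i> * of_real y)) \<longlongrightarrow> deriv (G n) ?z) (at_right (0::real))"
    by (rule filterlim_compose[OF G[unfolded DERIV_def] lim])
  then have "((\<lambda>y. Re ((G n (?z + \<i> * of_real y) - G n ?z) / (\<i> * of_real y))) \<longlongrightarrow> Re (deriv (G n) ?z)) (at_right (0::real))"
    by (rule tendsto_Re)
  moreover have "eventually (\<lambda>y. 0 \<le> Re ((G n (?z + \<i> * of_real y) - G n ?z) / (\<i> * of_real y))) (at_right (0::real))"
  proof (rule eventually_at_right_less[THEN eventually_mono])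
    fix y :: real assume "0 < y"
    then have "Re ((G n (?z + \<i> * of_real y) - G n ?z) / (\<i> * of_real y)) = Im (G n (?z + \<i> * of_real y)) / y"
      using Im_G_real[of n x] by (simp add: Re_divide power2_eq_square)
    moreover have "Im (G n (?z + \<i> * of_real y)) \<ge> 0"
      using \<open>0 < y\<close> by (intro Im_G_nonneg) simp
    ultimately show "0 \<le> Re ((G n (?z + \<i> * of_real y) - G n ?z) / (\<i> * of_real y))"
      using \<open>0 < y\<close> by simp
  qed
  ultimately show ?thesis by (rule tendsto_lowerbound) simp
qed

lemma deriv_J_nonzero: "deriv J (of_real x) \<noteq> 0"
proof -
  obtain n where n: "near n (of_real x)" using near_ex by blast
  have "Re (of_real (\<mu> n) + of_real ((a n - x)\<^sup>2) * deriv (G n) (of_real x)) > 0"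
    using pos[of n] Re_deriv_G_nonneg[OF n] by (simp add: add_pos_nonneg)
  then have "of_real (\<mu> n) + of_real ((a n - x)\<^sup>2) * deriv (G n) (of_real x) \<noteq> 0"
    by (metis less_irrefl zero_complex.simps(1))
  then show ?thesis using den_nonzero[of "of_real x" n] unfolding deriv_J[OF n] by simp
qed

lemma norm_deriv_J_le:
  assumes e: "e > 0" "\<And>k. k \<noteq> n \<Longrightarrow> e \<le> \<bar>a k - x\<bar>"
  shows "norm (deriv J (of_real x)) \<le> 8 * (1 + \<bar>b\<bar> + mass / e)\<^sup>2 / \<mu> n + 16 * mass / e\<^sup>2"
proof -
  define g where "g = Re (G n (of_real x))"
  define G' where "G' = deriv (G n) (of_real x)"
  define u where "u = a n - x"
  define Q where "Q = (\<mu> n + u * g)\<^sup>2 + u\<^sup>2"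
  define B where "B = 1 + \<bar>b\<bar> + mass / e"
  have e': "e \<le> norm (of_real (a k) - of_real x :: complex)" if "k \<in> -{n}" for k
    using e(2)[of k] that by (simp flip: of_real_diff)
  have n: "near n (of_real x)" unfolding near_def using e(1) e' by (intro exI[of _ e]) auto
  have "\<bar>g\<bar> \<le> norm (G n (of_real x))" unfolding g_def by (rule abs_Re_le_cmod)
  also have "\<dots> \<le> \<bar>b\<bar> + mass / e"
    unfolding G_def using norm_triangle_ineq[of "of_real b" "S (-{n}) (of_real x)"] norm_S_le[OF e(1) e', of "-{n}"]
    by simp
  finally have g: "1 + \<bar>g\<bar> \<le> B" by (simp add: B_def)
  have "G' = deriv (S (-{n})) (of_real x)"
    unfolding G'_def G_def[abs_def] 
    by (subst deriv_add) (auto intro!: analytic_on_imp_differentiable_at[OF analytic_S[OF e(1) e']])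
  with norm_deriv_S_le[OF e(1) e', of "-{n}"] have G': "norm G' \<le> 8 * mass / e\<^sup>2" by simp
  have B: "B \<ge> 1" using g by linarith
  have Q0: "Q > 0"
    using pos[of n] unfolding Q_def by (cases "u = 0") (auto intro: add_nonneg_pos)
  have 1: "\<mu> n / Q \<le> 4 * B\<^sup>2 / \<mu> n"
  proof (cases "\<bar>u\<bar> * B \<le> \<mu> n / 2")
    case True
    have "\<bar>u * g\<bar> \<le> \<bar>u\<bar> * B" unfolding abs_mult using g by (intro mult_left_mono) auto
    then have "\<mu> n / 2 \<le> \<mu> n + u * g" using True by linarith
    then have "(\<mu> n / 2)\<^sup>2 \<le> Q" 
      unfolding Q_def using pos[of n] by (smt (verit) power_mono zero_le_power2 half_gt_zero)
    then have "\<mu> n / Q \<le> \<mu> n / (\<mu> n / 2)\<^sup>2"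
      using pos[of n] Q0 by (intro divide_left_mono) auto
    also have "\<dots> = 4 * 1 / \<mu> n" using pos[of n] by (simp add: power2_eq_square)
    also have "\<dots> \<le> 4 * B\<^sup>2 / \<mu> n"
      using pos[of n] B by (intro divide_right_mono mult_left_mono) auto
    finally show ?thesis .
  next
    case False
    then have "(\<mu> n / 2)\<^sup>2 \<le> (\<bar>u\<bar> * B)\<^sup>2" using pos[of n] by (intro power_mono) auto
    also have "\<dots> \<le> Q * B\<^sup>2" unfolding Q_def power_mult_distrib by (intro mult_right_mono) auto
    finally show ?thesis using pos[of n] Q0 by (simp add: field_simps power2_eq_square)
  qed
  have 2: "u\<^sup>2 * norm G' / Q \<le> norm G'"
    using Q0 mult_right_mono[of "u\<^sup>2" Q "norm G'"] by (simp add: divide_le_eq Q_def mult.commute)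
  have "norm (deriv J (of_real x)) = 2 * norm (of_real (\<mu> n) + of_real (u\<^sup>2) * G') / Q"
    unfolding norm_deriv_J[OF n] Q_def u_def g_def G'_def ..
  also have "\<dots> \<le> 2 * (\<mu> n + u\<^sup>2 * norm G') / Q"
    using Q0 pos[of n] norm_triangle_ineq[of "of_real (\<mu> n)" "of_real (u\<^sup>2) * G'"]
    by (intro divide_right_mono mult_left_mono) (auto simp: norm_mult norm_power)
  also have "\<dots> = 2 * (\<mu> n / Q) + 2 * (u\<^sup>2 * norm G' / Q)" by (simp add: add_divide_distrib distrib_left)
  also have "\<dots> \<le> 2 * (4 * B\<^sup>2 / \<mu> n) + 2 * (8 * mass / e\<^sup>2)"
    using 1 2 G' by linarith
  finally show ?thesis by (simp add: B_def)
qed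

lemma f_sum: "f x = b + (\<Sum>\<^sub>\<infinity>k. \<mu> k / (a k - x))"
  unfolding f_def F_def S_of_real by simp

lemma f_mono:
  assumes "x \<le> y" "\<And>k. a k \<notin> {x..y}"
  shows "f x \<le> f y"
proof -
  have "\<mu> k / (a k - x) \<le> \<mu> k / (a k - y)" for k
  proof (cases "a k < x")
    case True then show ?thesis using assms(1) pos[of k] by (simp add: divide_le_eq field_simps)
  next
    case False
    then have "a k > y" using assms(2)[of k] by auto
    then show ?thesis using assms(1) pos[of k] by (intro divide_left_mono mult_pos_pos) auto
  qed
  then show ?thesis
    unfolding f_sum by (intro add_left_mono infsum_mono summable_terms_real)
qed

lemma f_sign_near_node: "eventually (\<lambda>x. f x * (a n - x) > 0) (at (a n))"
proof -
  have "isCont (G n) (of_real (a n))"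
    by (intro analytic_at_imp_isCont analytic_G near_node)
  then have "((\<lambda>x. G n (of_real x)) \<longlongrightarrow> G n (of_real (a n))) (at (a n))"
    by (rule isCont_tendsto_compose) (intro tendsto_intros)
  then have "((\<lambda>x. \<mu> n + (a n - x) * Re (G n (of_real x))) \<longlongrightarrow> \<mu> n + (a n - a n) * Re (G n (of_real (a n)))) (at (a n))"
    by (intro tendsto_intros)
  then have "eventually (\<lambda>x. \<mu> n + (a n - x) * Re (G n (of_real x)) > 0) (at (a n))"
    using pos[of n] by (intro order_tendstoD) auto
  moreover have "eventually (\<lambda>x. x \<noteq> a n) (at (a n))" by (rule eventually_neq_at_within)
  ultimately show ?thesis
  proof eventually_elim
    case (elim x)
    have "f x = \<mu> n / (a n - x) + Re (G n (of_real x))"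
      unfolding f_def F_eq[of _ n] by (simp flip: of_real_diff of_real_divide)
    then show ?case using elim by (simp add: field_simps)
  qed
qed

lemma phase_step:
  fixes \<phi> :: "real \<Rightarrow> real"
  assumes cont: "continuous_on UNIV \<phi>" and cis: "\<And>x. J (of_real x) = cis (\<phi> x)"
    and start: "\<phi> (a n) = 2 * pi * of_int j"
  shows "\<phi> (a (n+1)) = 2 * pi * of_int (j+1)"
    and "\<And>x. x \<in> {a n<..<a (n+1)} \<Longrightarrow> \<phi> x \<in> {2 * pi * of_int j <..< 2 * pi * of_int (j+1)}"
proof -
  have lt: "a n < a (n+1)" using mono by (simp add: strict_mono_def)
  have no_node: "x \<notin> range a" if "x \<in> {a n<..<a (n+1)}" for x
    using that mono by (auto simp: strict_mono_less)
  have no_int: "\<phi> x \<noteq> 2 * pi * of_int i" if "x \<in> {a n<..<a (n+1)}" for x i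
  proof
    assume "\<phi> x = 2 * pi * of_int i"
    then have "J (of_real x) = 1" by (simp add: cis complex_eq_iff)
    with no_node[OF that] show False by (simp add: J_eq_1_iff)
  qed
  have sin: "sin (\<phi> x) = - 2 * f x / ((f x)\<^sup>2 + 1)" if "x \<in> {a n<..<a (n+1)}" for x
    using J_real(2)[OF no_node[OF that]] by (simp add: cis)
  have close: "eventually (\<lambda>x. \<bar>\<phi> x - \<phi> c\<bar> < pi) (at c)" for c
    using cont pi_gt_zero unfolding continuous_on_eq_continuous_at[OF open_UNIV] isCont_def tendsto_iff dist_real_def by blast
  have "eventually (\<lambda>x. f x * (a n - x) > 0 \<and> \<bar>\<phi> x - \<phi> (a n)\<bar> < pi \<and> x \<in> {a n<..<a (n+1)}) (at_right (a n))"
    using f_sign_near_node[of "n"] close[of "a n"] unfolding eventually_at_split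
    by (intro eventually_conj eventually_at_right_real lt) simp_all
  then obtain x0 where x0: "f x0 * (a n - x0) > 0" "\<bar>\<phi> x0 - \<phi> (a n)\<bar> < pi" "x0 \<in> {a n<..<a (n+1)}"
    using eventually_happens'[OF trivial_limit_at_right_real] by blast
  have pos1: "(t::real)\<^sup>2 + 1 > 0" for t by (simp add: add_nonneg_pos)
  have "f x0 < 0" using x0(1,3) by (simp add: zero_less_mult_iff)
  then have "sin (\<phi> x0) > 0" unfolding sin[OF x0(3)] using pos1[of "f x0"] by (simp add: divide_neg_pos)
  moreover have "sin (\<phi> x0) = sin (\<phi> x0 - \<phi> (a n))" unfolding start sin_diff by simp
  ultimately have s0: "\<phi> x0 > \<phi> (a n)"
    using x0(2) sin_ge_zero[of "\<phi> (a n) - \<phi> x0"] by (smt (verit) sin_minus)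
  \<comment> \<open>\<open>J = 1\<close> only at nodes, so \<open>\<phi>\<close> cannot leave the interval it enters just to the right of \<open>a n\<close>.\<close>
  show *: "\<phi> x \<in> {2 * pi * of_int j <..< 2 * pi * of_int (j+1)}" if "x \<in> {a n<..<a (n+1)}" for x
  proof (rule ccontr)
    assume neg: "\<not> ?thesis"
    have "connected (\<phi> ` {a n<..<a (n+1)})"
      by (intro connected_continuous_image continuous_on_subset[OF cont]) auto
    then have "is_interval (\<phi> ` {a n<..<a (n+1)})" by (simp add: is_interval_connected_1)
    then have iv: "t \<in> \<phi> ` {a n<..<a (n+1)}"
      if "\<phi> y \<le> t" "t \<le> \<phi> z" "y \<in> {a n<..<a (n+1)}" "z \<in> {a n<..<a (n+1)}" for t y z
      using that unfolding is_interval_1 by blast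
    have r: "2 * pi * of_int j < \<phi> x0" "\<phi> x0 < 2 * pi * of_int (j+1)"
      using s0 x0(2) start pi_gt_zero by (auto simp: algebra_simps)
    have "\<phi> x \<le> 2 * pi * of_int j \<or> 2 * pi * of_int (j+1) \<le> \<phi> x" using neg by auto
    then show False
    proof
      assume "\<phi> x \<le> 2 * pi * of_int j"
      from iv[OF this _ that x0(3)] r no_int[of _ j] show False by force
    next
      assume "2 * pi * of_int (j+1) \<le> \<phi> x"
      from iv[OF _ this x0(3) that] r no_int[of _ "j+1"] show False by force
    qed
  qed
  have "cis (\<phi> (a (n+1))) = 1" using J_node[of "n+1"] by (simp add: cis)
  then obtain l :: int where l: "\<phi> (a (n+1)) = 2 * pi * of_int l"
    by (auto simp: complex_eq_iff cos_one_2pi_int mult_ac)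
  have "eventually (\<lambda>x. f x * (a (n+1) - x) > 0 \<and> \<bar>\<phi> x - \<phi> (a (n+1))\<bar> < pi \<and> x \<in> {a n<..<a (n+1)}) (at_left (a (n+1)))"
    using f_sign_near_node[of "n+1"] close[of "a (n+1)"] unfolding eventually_at_split
    by (intro eventually_conj eventually_at_left_real lt) simp_all
  then obtain x1 where x1: "f x1 * (a (n+1) - x1) > 0" "\<bar>\<phi> x1 - \<phi> (a (n+1))\<bar> < pi" "x1 \<in> {a n<..<a (n+1)}"
    using eventually_happens'[OF trivial_limit_at_left_real] by blast
  have "f x1 > 0" using x1(1,3) by (simp add: zero_less_mult_iff)
  then have "sin (\<phi> x1) < 0" unfolding sin[OF x1(3)] using pos1[of "f x1"] by (simp add: divide_neg_pos)
  moreover have "sin (\<phi> x1) = sin (\<phi> x1 - \<phi> (a (n+1)))" unfolding l sin_diff by simp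
  ultimately have s1: "\<phi> x1 < \<phi> (a (n+1))"
    using x1(2) sin_ge_zero[of "\<phi> x1 - \<phi> (a (n+1))"] by (smt (verit))
  have "2 * pi * of_int j < 2 * pi * of_int l" using *[OF x1(3)] s1 unfolding l
    unfolding greaterThanLessThan_iff by linarith
  moreover have "2 * pi * (of_int l - 1/2) < 2 * pi * of_int (j + 1)"
    using *[OF x1(3)] s1 x1(2) unfolding l by (simp add: algebra_simps)
  ultimately have "real_of_int j < of_int l" "of_int l - 1/2 < real_of_int (j+1)"
    using pi_gt_zero by (auto simp only: mult_less_cancel_left_pos mult_pos_pos zero_less_numeral)
  then have "l = j + 1" by linarith
  then show "\<phi> (a (n+1)) = 2 * pi * of_int (j+1)" using l by simp
qed

lemma phase_node:
  assumes "continuous_on UNIV \<phi>" "\<And>x. J (of_real x) = cis (\<phi> x)" "\<phi> (a 0) = 0"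
  shows "\<phi> (a n) = 2 * pi * of_int n"
proof (induction n rule: int_induct[where k = 0])
  case base then show ?case using assms(3) by simp
next
  case (step1 i) then show ?case using phase_step(1)[OF assms(1,2), of i i] by simp
next
  case (step2 i)
  have "cis (\<phi> (a (i-1))) = 1" using J_node[of "i-1"] by (simp add: assms(2))
  then obtain l :: int where l: "\<phi> (a (i-1)) = 2 * pi * of_int l"
    by (auto simp: complex_eq_iff cos_one_2pi_int mult_ac)
  from phase_step(1)[OF assms(1,2) l] step2 have "2 * pi * real_of_int i = 2 * pi * of_int (l+1)" by simp
  then have "i = l + 1" by simp
  then show ?case using l by simp
qed

end

section \<open>Regularity of the weight\<close>

lemma bracket_pos: "\<langle>x\<rangle> > 0" and bracket_ge_1: "\<langle>x\<rangle> \<ge> 1" and bracket_sq: "\<langle>x\<rangle>\<^sup>2 = 1 + x\<^sup>2"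
  and abs_le_bracket: "\<bar>x\<bar> \<le> \<langle>x\<rangle>"
proof -
  show "\<langle>x\<rangle> \<ge> 1" unfolding japanese_bracket_def by simp
  then show "\<langle>x\<rangle> > 0" by linarith
  show "\<langle>x\<rangle>\<^sup>2 = 1 + x\<^sup>2" unfolding japanese_bracket_def by (simp add: add_nonneg_nonneg)
  show "\<bar>x\<bar> \<le> \<langle>x\<rangle>"
    unfolding japanese_bracket_def by (intro real_le_rsqrt) simp
qed

lemma bracket_add_le: "\<langle>y\<rangle> \<le> \<langle>x\<rangle> + \<bar>y - x\<bar>"
proof (rule power2_le_imp_le)
  have "y\<^sup>2 = x\<^sup>2 + 2 * x * (y - x) + (y - x)\<^sup>2" by (simp add: power2_eq_square algebra_simps)
  moreover have "x * (y - x) \<le> \<langle>x\<rangle> * \<bar>y - x\<bar>"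
  proof -
    have "x * (y - x) \<le> \<bar>x\<bar> * \<bar>y - x\<bar>" by (metis abs_ge_self abs_mult)
    also have "\<dots> \<le> \<langle>x\<rangle> * \<bar>y - x\<bar>" by (intro mult_right_mono abs_le_bracket) simp
    finally show ?thesis .
  qed
  ultimately show "\<langle>y\<rangle>\<^sup>2 \<le> (\<langle>x\<rangle> + \<bar>y - x\<bar>)\<^sup>2"
    unfolding power2_sum bracket_sq by simp
qed (use bracket_pos[of x] in simp)

lemma smooth_has_derivs:
  assumes "smooth \<alpha>"
  shows "\<And>x. (\<alpha> has_real_derivative deriv \<alpha> x) (at x)"
    and "\<And>x. (deriv \<alpha> has_real_derivative deriv (deriv \<alpha>) x) (at x)"
    and "continuous_on UNIV (deriv (deriv \<alpha>))"
proof -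
  have d: "(deriv ^^ n) \<alpha> differentiable_on UNIV" for n
    using assms unfolding smooth_def by blast
  have D: "((deriv ^^ n) \<alpha> has_real_derivative deriv ((deriv ^^ n) \<alpha>) x) (at x)" for n x
    using d[of n] unfolding differentiable_on_def
    by (metis UNIV_I DERIV_deriv_iff_real_differentiable)
  show "\<And>x. (\<alpha> has_real_derivative deriv \<alpha> x) (at x)" using D[of 0] by simp
  show "\<And>x. (deriv \<alpha> has_real_derivative deriv (deriv \<alpha>) x) (at x)" using D[of 1] by simp
  show "continuous_on UNIV (deriv (deriv \<alpha>))"
    using differentiable_imp_continuous_on[OF d[of 2]] by (simp add: numeral_2_eq_2)
qed

text \<open>The bound on the second derivative is only assumed far out, but by compactness it holds globally
  with a larger constant. It makes \<open>ln (deriv \<alpha>)\<close> Lipschitz with respect to \<open>weight_dist \<alpha>\<close>.\<close>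

locale weight =
  fixes \<alpha> :: "real \<Rightarrow> real" and C c \<kappa> :: real
  assumes deriv1: "\<And>x. (\<alpha> has_real_derivative deriv \<alpha> x) (at x)"
    and deriv2: "\<And>x. (deriv \<alpha> has_real_derivative deriv (deriv \<alpha>) x) (at x)"
    and C: "C \<ge> 0" "\<And>x. \<bar>deriv (deriv \<alpha>) x\<bar> \<le> C * (deriv \<alpha> x)\<^sup>2"
    and c: "c > 0" "\<And>x. c * \<langle>x\<rangle> powr (-\<kappa>) \<le> deriv \<alpha> x"
    and kappa: "\<kappa> < 1"
begin

lemma deriv_pos: "deriv \<alpha> x > 0"
proof -
  have "0 < c * \<langle>x\<rangle> powr (-\<kappa>)" using c(1) bracket_pos[of x] by simp
  also have "\<dots> \<le> deriv \<alpha> x" by (rule c(2))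
  finally show ?thesis .
qed

lemma deriv_lower: "c / \<langle>x\<rangle> \<le> deriv \<alpha> x"
proof -
  have "\<langle>x\<rangle> powr (-1) \<le> \<langle>x\<rangle> powr (-\<kappa>)"
    using kappa bracket_ge_1[of x] by (intro powr_mono) auto
  then have "c * \<langle>x\<rangle> powr (-1) \<le> c * \<langle>x\<rangle> powr (-\<kappa>)"
    using c(1) by (intro mult_left_mono) auto
  then have "c * \<langle>x\<rangle> powr (-1) \<le> deriv \<alpha> x" using c(2)[of x] by (rule order_trans)
  then show ?thesis using bracket_pos[of x] by (simp add: powr_minus_divide)
qed

lemma strict_mono_weight: "strict_mono \<alpha>"
proof (rule strict_monoI)
  fix x y :: real assume "x < y"
  then show "\<alpha> x < \<alpha> y"
    by (rule DERIV_pos_imp_increasing) (use deriv1 deriv_pos in blast)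
qed

lemma continuous_weight: "continuous_on A \<alpha>"
  by (intro continuous_at_imp_continuous_on ballI DERIV_isCont[OF deriv1])

lemma deriv_le_exp: "deriv \<alpha> y \<le> exp (C * \<bar>\<alpha> y - \<alpha> x\<bar>) * deriv \<alpha> x"
proof -
  have dl: "((\<lambda>x. ln (deriv \<alpha> x)) has_real_derivative deriv (deriv \<alpha>) x / deriv \<alpha> x) (at x)" for x
    using deriv_pos[of x] by (auto intro!: derivative_eq_intros deriv2)
  have bd: "\<bar>deriv (deriv \<alpha>) x / deriv \<alpha> x\<bar> \<le> C * deriv \<alpha> x" for x
    using C(2)[of x] deriv_pos[of x] by (simp add: abs_divide divide_le_eq power2_eq_square mult.assoc)
  have *: "\<bar>ln (deriv \<alpha> y) - ln (deriv \<alpha> x)\<bar> \<le> C * (\<alpha> y - \<alpha> x)" if "x \<le> y" for x y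
  proof -
    have "C * \<alpha> x - ln (deriv \<alpha> x) \<le> C * \<alpha> y - ln (deriv \<alpha> y)"
    proof (rule DERIV_nonneg_imp_nondecreasing[OF that])
      fix t
      show "\<exists>D. ((\<lambda>x. C * \<alpha> x - ln (deriv \<alpha> x)) has_real_derivative D) (at t) \<and> D \<ge> 0"
      proof (intro exI conjI)
        show "((\<lambda>x. C * \<alpha> x - ln (deriv \<alpha> x)) has_real_derivative
            C * deriv \<alpha> t - deriv (deriv \<alpha>) t / deriv \<alpha> t) (at t)"
          by (intro DERIV_diff DERIV_cmult deriv1 dl)
        show "0 \<le> C * deriv \<alpha> t - deriv (deriv \<alpha>) t / deriv \<alpha> t" using bd[of t] by linarith
      qed
    qed
    moreover have "C * \<alpha> x + ln (deriv \<alpha> x) \<le> C * \<alpha> y + ln (deriv \<alpha> y)"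
    proof (rule DERIV_nonneg_imp_nondecreasing[OF that])
      fix t
      show "\<exists>D. ((\<lambda>x. C * \<alpha> x + ln (deriv \<alpha> x)) has_real_derivative D) (at t) \<and> D \<ge> 0"
      proof (intro exI conjI)
        show "((\<lambda>x. C * \<alpha> x + ln (deriv \<alpha> x)) has_real_derivative
            C * deriv \<alpha> t + deriv (deriv \<alpha>) t / deriv \<alpha> t) (at t)"
          by (intro DERIV_add DERIV_cmult deriv1 dl)
        show "0 \<le> C * deriv \<alpha> t + deriv (deriv \<alpha>) t / deriv \<alpha> t" using bd[of t] by linarith
      qed
    qed
    ultimately show ?thesis by (simp add: algebra_simps abs_le_iff)
  qed
  have "ln (deriv \<alpha> y) \<le> C * \<bar>\<alpha> y - \<alpha> x\<bar> + ln (deriv \<alpha> x)"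
  proof (cases "x \<le> y")
    case True
    have "C * (\<alpha> y - \<alpha> x) \<le> C * \<bar>\<alpha> y - \<alpha> x\<bar>" using C(1) by (intro mult_left_mono) auto
    with *[OF True] show ?thesis by linarith
  next
    case False
    have "C * (\<alpha> x - \<alpha> y) \<le> C * \<bar>\<alpha> y - \<alpha> x\<bar>" using C(1) by (intro mult_left_mono) auto
    with *[of y x] False show ?thesis by linarith
  qed
  then have "exp (ln (deriv \<alpha> y)) \<le> exp (C * \<bar>\<alpha> y - \<alpha> x\<bar> + ln (deriv \<alpha> x))" by simp
  then show ?thesis using deriv_pos[of x] deriv_pos[of y] by (simp add: exp_add)
qed

lemma mean_value:
  obtains z where "\<alpha> y - \<alpha> x = (y - x) * deriv \<alpha> z" "min x y \<le> z" "z \<le> max x y"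
proof (cases x y rule: linorder_cases)
  case less
  obtain z where z: "z > x" "z < y" "\<alpha> y - \<alpha> x = (y - x) * deriv \<alpha> z"
    using MVT2[OF less, of \<alpha> "deriv \<alpha>"] deriv1 by blast
  show ?thesis by (rule that[of z]) (use z less in auto)
next
  case greater
  obtain z where z: "z > y" "z < x" "\<alpha> x - \<alpha> y = (x - y) * deriv \<alpha> z"
    using MVT2[OF greater, of \<alpha> "deriv \<alpha>"] deriv1 by blast
  show ?thesis by (rule that[of z]) (use z greater in \<open>auto simp: algebra_simps\<close>)
qed (use that[of x] in auto)

lemma between_dist:
  assumes "min x y \<le> z" "z \<le> max x y"
  shows "\<bar>\<alpha> z - \<alpha> x\<bar> \<le> \<bar>\<alpha> y - \<alpha> x\<bar>"
proof -
  have mono: "\<alpha> s \<le> \<alpha> t" if "s \<le> t" for s t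
    using that strict_mono_less_eq[OF strict_mono_weight] by blast
  show ?thesis
  proof (cases "x \<le> y")
    case True
    then have "\<alpha> x \<le> \<alpha> z" "\<alpha> z \<le> \<alpha> y" using assms by (auto intro!: mono)
    then show ?thesis by linarith
  next
    case False
    then have "\<alpha> y \<le> \<alpha> z" "\<alpha> z \<le> \<alpha> x" using assms by (auto intro!: mono)
    then show ?thesis by linarith
  qed
qed

lemma dist_le:
  "\<bar>y - x\<bar> \<le> exp (C * \<bar>\<alpha> y - \<alpha> x\<bar>) * \<bar>\<alpha> y - \<alpha> x\<bar> / deriv \<alpha> x"
proof -
  obtain z where z: "\<alpha> y - \<alpha> x = (y - x) * deriv \<alpha> z" "min x y \<le> z" "z \<le> max x y"
    by (rule mean_value)
  have "deriv \<alpha> x \<le> exp (C * \<bar>\<alpha> x - \<alpha> z\<bar>) * deriv \<alpha> z" by (rule deriv_le_exp)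
  also have "\<dots> \<le> exp (C * \<bar>\<alpha> y - \<alpha> x\<bar>) * deriv \<alpha> z"
    using between_dist[OF z(2,3)] C(1) deriv_pos[of z]
    by (intro mult_right_mono) (auto intro!: mult_left_mono simp: abs_minus_commute)
  finally have "\<bar>y - x\<bar> * deriv \<alpha> x \<le> \<bar>y - x\<bar> * (exp (C * \<bar>\<alpha> y - \<alpha> x\<bar>) * deriv \<alpha> z)"
    by (rule mult_left_mono) simp
  also have "\<dots> = exp (C * \<bar>\<alpha> y - \<alpha> x\<bar>) * (\<bar>y - x\<bar> * deriv \<alpha> z)"
    by (rule mult.left_commute)
  also have "\<bar>y - x\<bar> * deriv \<alpha> z = \<bar>\<alpha> y - \<alpha> x\<bar>"
    using deriv_pos[of z] by (simp add: z(1) abs_mult)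
  finally show ?thesis using deriv_pos[of x] by (simp add: pos_le_divide_eq)
qed

lemma dist_ge_1:
  assumes "\<bar>\<alpha> y - \<alpha> x\<bar> \<ge> 1"
  shows "exp (- C) / deriv \<alpha> x \<le> \<bar>y - x\<bar>"
proof -
  have "\<exists>y'. \<bar>\<alpha> y' - \<alpha> x\<bar> = 1 \<and> \<bar>y' - x\<bar> \<le> \<bar>y - x\<bar>"
  proof (cases "x \<le> y")
    case True
    then have "\<alpha> x + 1 \<le> \<alpha> y" using assms strict_mono_less_eq[OF strict_mono_weight, of x y] by auto
    then obtain t where "t \<ge> x" "t \<le> y" "\<alpha> t = \<alpha> x + 1"
      using IVT'[of \<alpha> x "\<alpha> x + 1" y] True continuous_weight by auto
    then show ?thesis by (intro exI[of _ t]) auto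
  next
    case False
    then have "\<alpha> y \<le> \<alpha> x - 1" using assms strict_mono_less[OF strict_mono_weight, of y x] by auto
    then obtain t where "t \<ge> y" "t \<le> x" "\<alpha> t = \<alpha> x - 1"
      using IVT'[of \<alpha> y "\<alpha> x - 1" x] False continuous_weight by auto
    then show ?thesis by (intro exI[of _ t]) auto
  qed
  then obtain y' where y': "\<bar>\<alpha> y' - \<alpha> x\<bar> = 1" "\<bar>y' - x\<bar> \<le> \<bar>y - x\<bar>" by blast
  obtain z where z: "\<alpha> y' - \<alpha> x = (y' - x) * deriv \<alpha> z" "min x y' \<le> z" "z \<le> max x y'"
    by (rule mean_value)
  have "deriv \<alpha> z \<le> exp (C * \<bar>\<alpha> z - \<alpha> x\<bar>) * deriv \<alpha> x" by (rule deriv_le_exp)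
  also have "\<dots> \<le> exp (C * 1) * deriv \<alpha> x"
    using between_dist[OF z(2,3)] C(1) deriv_pos[of x] y'(1)
    by (intro mult_right_mono) (auto intro!: mult_left_le)
  finally have "1 \<le> \<bar>y' - x\<bar> * (exp C * deriv \<alpha> x)"
    using y'(1) deriv_pos[of z] mult_left_mono[of "deriv \<alpha> z" _ "\<bar>y' - x\<bar>"] unfolding z(1) abs_mult by simp
  also have "\<dots> \<le> \<bar>y - x\<bar> * (exp C * deriv \<alpha> x)"
    using y'(2) deriv_pos[of x] by (intro mult_right_mono) auto
  finally have "exp (-C) * 1 \<le> exp (-C) * (\<bar>y - x\<bar> * (exp C * deriv \<alpha> x))"
    by (rule mult_left_mono) simp
  also have "\<dots> = (exp (-C) * exp C) * (\<bar>y - x\<bar> * deriv \<alpha> x)" by (simp only: mult_ac)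
  also have "exp (-C) * exp C = 1" by (simp flip: exp_add)
  finally show ?thesis using deriv_pos[of x] by (simp add: pos_divide_le_eq)
qed

lemma bracket_le:
  "\<langle>y\<rangle> \<le> (1 + exp (C * \<bar>\<alpha> y - \<alpha> x\<bar>) * \<bar>\<alpha> y - \<alpha> x\<bar> / c) * \<langle>x\<rangle>"
proof -
  define E where "E = exp (C * \<bar>\<alpha> y - \<alpha> x\<bar>) * \<bar>\<alpha> y - \<alpha> x\<bar>"
  have "\<langle>y\<rangle> \<le> \<langle>x\<rangle> + \<bar>y - x\<bar>" by (rule bracket_add_le)
  also have "\<bar>y - x\<bar> \<le> E / deriv \<alpha> x" unfolding E_def by (rule dist_le)
  also have "\<dots> \<le> E / (c / \<langle>x\<rangle>)"
    using deriv_lower[of x] c(1) bracket_pos[of x] deriv_pos[of x]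
    by (intro divide_left_mono) (auto simp: E_def)
  finally show ?thesis unfolding E_def by (simp add: algebra_simps)
qed

lemma weight_surj: "\<exists>x. \<alpha> x = t"
proof -
  have mono: "\<alpha> x - c * arsinh x \<le> \<alpha> y - c * arsinh y" if "x \<le> y" for x y
  proof (rule DERIV_nonneg_imp_nondecreasing[OF that])
    fix t
    show "\<exists>D. ((\<lambda>x. \<alpha> x - c * arsinh x) has_real_derivative D) (at t) \<and> D \<ge> 0"
      using deriv_lower[of t]
      by (intro exI[of _ "deriv \<alpha> t - c * (1 / sqrt (t\<^sup>2 + 1))"] conjI)
         (auto intro!: derivative_eq_intros deriv1 simp: japanese_bracket_def add.commute)
  qed
  define s where "s = \<bar>t - \<alpha> 0\<bar> / c"
  have s: "s \<ge> 0" using c(1) by (simp add: s_def)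
  have ar: "arsinh (sinh s) = s" "arsinh (sinh (-s)) = -s" by (simp_all only: arsinh_sinh_real)
  have "\<alpha> (sinh s) \<ge> t"
    using mono[of 0 "sinh s"] s c(1) ar by (simp add: s_def)
  moreover have "\<alpha> (sinh (-s)) \<le> t"
    using mono[of "sinh (-s)" 0] s c(1) ar by (simp add: s_def)
  ultimately show ?thesis
    using IVT'[of \<alpha> "sinh (-s)" t "sinh s"] s continuous_weight by auto
qed

definition w :: "real \<Rightarrow> real" where "w x = deriv \<alpha> x * \<langle>x\<rangle>"

lemma w_lower: "c \<le> w x"
  using deriv_lower[of x] bracket_pos[of x] by (simp add: w_def divide_le_eq)

lemma bracket_le_w: "\<exists>K>0. \<exists>P::nat. \<forall>x. \<langle>x\<rangle> \<le> K * w x ^ P"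
proof -
  obtain P :: nat where P: "1 / (1 - \<kappa>) \<le> real P" using real_arch_simple by blast
  define q where "q = (1 - \<kappa>) * real P"
  have q: "q \<ge> 1" using P kappa by (simp add: q_def field_simps)
  have "\<langle>x\<rangle> \<le> (1 / c ^ P) * w x ^ P" for x
  proof -
    have "c * \<langle>x\<rangle> powr (1 - \<kappa>) = c * \<langle>x\<rangle> powr (-\<kappa>) * \<langle>x\<rangle>"
      using bracket_pos[of x] by (simp add: powr_diff powr_minus_divide)
    also have "\<dots> \<le> w x"
      unfolding w_def using c(2)[of x] bracket_pos[of x] by (intro mult_right_mono) auto
    finally have "(c * \<langle>x\<rangle> powr (1 - \<kappa>)) ^ P \<le> w x ^ P"
      using c(1) by (intro power_mono) auto
    moreover have "(\<langle>x\<rangle> powr (1 - \<kappa>)) ^ P = \<langle>x\<rangle> powr q"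
      using bracket_pos[of x] by (simp add: q_def powr_power mult.commute)
    moreover have "\<langle>x\<rangle> powr 1 \<le> \<langle>x\<rangle> powr q" using q bracket_ge_1[of x] by (intro powr_mono) auto
    moreover have "c ^ P * \<langle>x\<rangle> \<le> c ^ P * \<langle>x\<rangle> powr q"
      using calculation(3) c(1) bracket_pos[of x] by (intro mult_left_mono) auto
    ultimately have "c ^ P * \<langle>x\<rangle> \<le> w x ^ P"
      by (simp add: power_mult_distrib)
    then show ?thesis using c(1) by (simp add: field_simps)
  qed
  then show ?thesis using c(1) by (intro exI[of _ "1 / c ^ P"] conjI exI[of _ P]) auto
qed

end

lemma regular_weightE:
  assumes "regular_locally_doubling_weight \<alpha>" "\<kappa> < 1"
    and "lesssim_on UNIV (\<lambda>x. \<langle>x\<rangle> powr (-\<kappa>)) (deriv \<alpha>)"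
  obtains C c where "weight \<alpha> C c \<kappa>"
proof -
  have "smooth \<alpha>" using assms(1) unfolding regular_locally_doubling_weight_def by blast
  note d = smooth_has_derivs[OF this]
  obtain C0 where C0: "C0 > 0" "\<And>x. \<langle>x\<rangle> powr (-\<kappa>) \<le> C0 * deriv \<alpha> x"
    using assms(3) unfolding lesssim_on_def by blast
  have pos: "deriv \<alpha> x > 0" for x
  proof -
    have "0 < C0 * deriv \<alpha> x" using less_le_trans[OF _ C0(2)[of x]] bracket_pos[of x] by simp
    then show ?thesis using C0(1) by (simp add: zero_less_mult_iff)
  qed
  obtain C1 R where R: "C1 > 0" "\<And>x. \<bar>x\<bar> \<ge> R \<Longrightarrow> \<bar>deriv (deriv \<alpha>) x\<bar> \<le> C1 * (deriv \<alpha> x)\<^sup>2"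
    using assms(1) unfolding regular_locally_doubling_weight_def by blast
  define h where "h x = \<bar>deriv (deriv \<alpha>) x\<bar> / (deriv \<alpha> x)\<^sup>2" for x
  have "continuous_on UNIV (deriv \<alpha>)"
    using d(2) DERIV_isCont continuous_at_imp_continuous_on by blast
  moreover have "deriv \<alpha> x \<noteq> 0" for x using pos[of x] by simp
  ultimately have "continuous_on {-R..R} h"
    unfolding h_def using d(3)
    by (intro continuous_intros) (auto intro: continuous_on_subset)
  then have "bounded (h ` {-R..R})" by (intro compact_imp_bounded compact_continuous_image) auto
  then obtain B where B: "\<And>x. x \<in> {-R..R} \<Longrightarrow> h x \<le> B"
    unfolding bounded_iff real_norm_def by (meson abs_le_D1 imageI)
  have "\<bar>deriv (deriv \<alpha>) x\<bar> \<le> max C1 B * (deriv \<alpha> x)\<^sup>2" for x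
  proof (cases "\<bar>x\<bar> \<ge> R")
    case True
    from R(2)[OF this] show ?thesis by (rule order_trans) (intro mult_right_mono; simp)
  next
    case False
    then have "x \<in> {-R..R}" by (auto simp: abs_less_iff)
    from B[OF this] have "h x \<le> max C1 B" by simp
    then show ?thesis using pos[of x] by (simp add: h_def divide_le_eq)
  qed
  moreover have "1 / C0 * \<langle>x\<rangle> powr (-\<kappa>) \<le> deriv \<alpha> x" for x
    using C0 by (simp add: pos_divide_le_eq mult.commute)
  ultimately have "weight \<alpha> (max C1 B) (1 / C0) \<kappa>"
    using d(1,2) C0(1) R(1) assms(2) by (intro weight.intro) auto
  then show ?thesis by (rule that)
qed

section \<open>The inner function of a weight\<close>

locale shifted_weight = weight +
  fixes k\<^sub>0 :: int
  assumes base: "\<bar>\<alpha> 0 - 2 * pi * of_int k\<^sub>0\<bar> \<le> pi"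
begin

text \<open>The nodes are the solutions of \<open>\<alpha> x = 0 mod 2\<pi>\<close>, except that the one with index \<open>0\<close> is moved to the origin,
  which forces \<open>J 0 = 1\<close>. The point \<open>centre\<close> it replaces may therefore lie strictly between two nodes;
  the offset puts the zero of \<open>F\<close> there, i.e. \<open>J centre = -1\<close>, so that near the origin the argument
  deviates from \<open>\<alpha>\<close> by at most \<open>2\<pi>\<close> in spite of the displaced node.\<close>

definition level :: "int \<Rightarrow> real" where
  "level n = (if n = 0 then \<alpha> 0 else 2 * pi * of_int (k\<^sub>0 + n))"

definition node :: "int \<Rightarrow> real" where "node n = (SOME x. \<alpha> x = level n)"

definition centre :: real where "centre = (SOME x. \<alpha> x = 2 * pi * of_int k\<^sub>0)"

text \<open>These masses are summable by telescoping, and \<open>1 / gap n\<close> is comparable to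
  \<open>deriv \<alpha> (node n) * \<langle>node n\<rangle>\<^sup>2\<close>.\<close>

definition gap :: "int \<Rightarrow> real" where "gap n = arctan (node (n+1)) - arctan (node n)"

definition offset :: real where "offset = - (\<Sum>\<^sub>\<infinity>n. gap n / (node n - centre))"

lemma weight_node: "\<alpha> (node n) = level n"
  unfolding node_def by (rule someI_ex, rule weight_surj)

lemma weight_centre: "\<alpha> centre = 2 * pi * of_int k\<^sub>0"
  unfolding centre_def by (rule someI_ex, rule weight_surj)

lemmas weight_less_iff = strict_mono_less[OF strict_mono_weight]
lemmas weight_le_iff = strict_mono_less_eq[OF strict_mono_weight]
lemmas weight_eq_iff = strict_mono_eq[OF strict_mono_weight]

lemma node_0: "node 0 = 0"
  using weight_node[of 0] by (simp add: level_def weight_eq_iff)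

lemma level_diff:
  assumes "i < j" shows "pi \<le> level j - level i"
proof -
  define \<theta> X Y where "\<theta> = \<alpha> 0 - 2 * pi * of_int k\<^sub>0" and "X = 2 * pi * of_int j" and "Y = 2 * pi * of_int i"
  have "2 * pi * 1 \<le> 2 * pi * (of_int j - of_int i)"
    using assms by (intro mult_left_mono) (auto simp flip: of_int_diff)
  then have "2 * pi \<le> X - Y" by (simp add: X_def Y_def right_diff_distrib)
  moreover have "j = 0 \<Longrightarrow> X = 0" "i = 0 \<Longrightarrow> Y = 0" by (simp_all add: X_def Y_def)
  moreover have "\<bar>\<theta>\<bar> \<le> pi" using base by (simp add: \<theta>_def)
  moreover have "level j - level i = (if j = 0 then \<theta> else X) - (if i = 0 then \<theta> else Y)"
    by (simp add: level_def \<theta>_def X_def Y_def distrib_left)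
  ultimately show ?thesis using assms by (auto split: if_splits)
qed

lemma level_step: "level (n+1) - level n \<le> 3 * pi"
proof -
  define \<theta> X where "\<theta> = \<alpha> 0 - 2 * pi * of_int k\<^sub>0" and "X = 2 * pi * of_int n"
  have "n = 0 \<Longrightarrow> X = 0" "n + 1 = 0 \<Longrightarrow> X + 2 * pi = 0" by (auto simp: X_def add_eq_0_iff)
  moreover have "\<bar>\<theta>\<bar> \<le> pi" using base by (simp add: \<theta>_def)
  moreover have "level (n+1) - level n = (if n + 1 = 0 then \<theta> else X + 2 * pi) - (if n = 0 then \<theta> else X)"
    by (simp add: level_def \<theta>_def X_def distrib_left)
  ultimately show ?thesis using pi_gt_zero by (auto split: if_splits)
qed

lemma strict_mono_node: "strict_mono node"
proof (rule strict_monoI)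
  fix i j :: int assume "i < j"
  from level_diff[OF this] have "\<alpha> (node i) < \<alpha> (node j)"
    using pi_gt_zero unfolding weight_node by linarith
  then show "node i < node j" by (simp add: weight_less_iff)
qed

lemma nearest:
  "\<exists>n. \<bar>\<alpha> x - level n\<bar> \<le> 2 * pi \<and> (\<forall>k. k \<noteq> n \<longrightarrow> 1 \<le> \<bar>\<alpha> x - level k\<bar>)"
proof -
  have pi2: "pi / 2 \<ge> 1" using pi_ge_two by simp
  define t where "t = \<alpha> x - 2 * pi * of_int k\<^sub>0"
  define \<theta> where "\<theta> = \<alpha> 0 - 2 * pi * of_int k\<^sub>0"
  have \<theta>: "\<bar>\<theta>\<bar> \<le> pi" using base by (simp add: \<theta>_def)
  have lev: "\<alpha> x - level k = (if k = 0 then t - \<theta> else t - 2 * pi * of_int k)" for k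
    by (simp add: level_def t_def \<theta>_def algebra_simps)
  have sep: "2 * pi \<le> \<bar>2 * pi * of_int i - 2 * pi * of_int j\<bar>" if "i \<noteq> j" for i j :: int
  proof -
    have "2 * pi * 1 \<le> 2 * pi * \<bar>of_int i - of_int j\<bar>"
      using that by (intro mult_left_mono) (auto simp flip: of_int_diff of_int_abs)
    then show ?thesis by (simp add: abs_mult flip: right_diff_distrib)
  qed
  show ?thesis
  proof (cases "\<bar>t - \<theta>\<bar> < pi / 2")
    case True
    have "1 \<le> \<bar>\<alpha> x - level k\<bar>" if "k \<noteq> 0" for k
    proof -
      have "\<alpha> x - level k = t - 2 * pi * of_int k" using lev[of k] that by simp
      moreover have "2 * pi \<le> \<bar>2 * pi * of_int k\<bar>" using sep[OF that] by simp
      ultimately show ?thesis using True \<theta> pi2 by linarith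
    qed
    then show ?thesis using True pi2 by (intro exI[of _ 0]) (auto simp: lev)
  next
    case False
    define n where "n = round (t / (2 * pi))"
    have "\<bar>of_int n - t / (2 * pi)\<bar> \<le> 1/2" unfolding n_def by (rule of_int_round_abs_le)
    then have "2 * pi * \<bar>of_int n - t / (2 * pi)\<bar> \<le> 2 * pi * (1/2)"
      by (intro mult_left_mono) auto
    moreover have "2 * pi * \<bar>of_int n - t / (2 * pi)\<bar> = \<bar>2 * pi * of_int n - t\<bar>"
      using abs_mult[of "2 * pi" "of_int n - t / (2 * pi)"] by (simp add: right_diff_distrib)
    ultimately have n: "\<bar>t - 2 * pi * of_int n\<bar> \<le> pi" by (simp add: abs_minus_commute)
    have "1 \<le> \<bar>\<alpha> x - level k\<bar>" if "k \<noteq> n" for k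
      using sep[OF that] n False pi2 unfolding lev by (auto split: if_splits)
    moreover have "\<bar>\<alpha> x - level n\<bar> \<le> 2 * pi"
      using n \<theta> pi_gt_zero unfolding lev by (auto split: if_splits)
    ultimately show ?thesis by blast
  qed
qed

lemma nearest_node:
  obtains n where "\<bar>\<alpha> x - \<alpha> (node n)\<bar> \<le> 2 * pi"
    and "\<And>k. k \<noteq> n \<Longrightarrow> exp (- C) / deriv \<alpha> x \<le> \<bar>node k - x\<bar>"
proof -
  obtain n where n: "\<bar>\<alpha> x - level n\<bar> \<le> 2 * pi" "\<And>k. k \<noteq> n \<Longrightarrow> 1 \<le> \<bar>\<alpha> x - level k\<bar>"
    using nearest by blast
  have "exp (- C) / deriv \<alpha> x \<le> \<bar>node k - x\<bar>" if "k \<noteq> n" for k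
    using n(2)[OF that] by (intro dist_ge_1) (simp add: weight_node abs_minus_commute)
  with n(1) that[of n] show ?thesis by (simp add: weight_node)
qed

lemma gap_pos: "gap n > 0"
  using strict_monoD[OF strict_mono_node, of n "n+1"] by (simp add: gap_def arctan_less_iff)

lemma gap_le_pi: "gap n \<le> pi"
  using arctan_bounded[of "node n"] arctan_bounded[of "node (n+1)"] by (simp add: gap_def)

lemma sum_gap: "sum gap {- int N..<int N} = arctan (node (int N)) - arctan (node (- int N))"
proof (induction N)
  case (Suc N)
  have *: "{- (int N + 1)..<int N + 1} = insert (- (int N + 1)) (insert (int N) {- int N..<int N})"
    by auto
  have "int (Suc N) = int N + 1" by simp
  then show ?case unfolding \<open>int (Suc N) = int N + 1\<close> * using Suc by (simp add: gap_def)
qed simp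

lemma summable_gap: "gap summable_on UNIV"
proof (rule nonneg_bdd_above_summable_on)
  have "sum gap A \<le> pi" if "finite A" for A
  proof -
    define N where "N = nat (Max (insert 0 (abs ` A)) + 1)"
    have "\<bar>x\<bar> < int N" if "x \<in> A" for x
    proof -
      have "\<bar>x\<bar> \<le> Max (insert 0 (abs ` A))" using \<open>finite A\<close> that by (intro Max_ge) auto
      then show ?thesis by (simp add: N_def)
    qed
    then have "A \<subseteq> {- int N..<int N}" by (force simp: abs_less_iff)
    then have "sum gap A \<le> sum gap {- int N..<int N}"
      using gap_pos by (intro sum_mono2) (auto simp: less_imp_le)
    also have "\<dots> \<le> pi"
      unfolding sum_gap using arctan_bounded[of "node (int N)"] arctan_bounded[of "node (- int N)"] by simp
    finally show ?thesis .
  qed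
  then show "bdd_above (sum gap ` {F. F \<subseteq> UNIV \<and> finite F})" by (auto intro!: bdd_aboveI)
qed (use gap_pos in \<open>auto simp: less_imp_le\<close>)

sublocale clark node gap offset
proof
  show "\<exists>n. \<exists>e>0. \<forall>k. k \<noteq> n \<longrightarrow> e \<le> \<bar>node k - x\<bar>" for x
  proof -
    obtain n where "\<And>k. k \<noteq> n \<Longrightarrow> exp (- C) / deriv \<alpha> x \<le> \<bar>node k - x\<bar>"
      using nearest_node[of x] by blast
    then show ?thesis using deriv_pos[of x] by (intro exI[of _ n] exI[of _ "exp (- C) / deriv \<alpha> x"]) auto
  qed
qed (use strict_mono_node gap_pos summable_gap in auto)

lemma f_centre: "f centre = 0"
  unfolding f_sum by (simp add: offset_def)

lemma gap_lower: "\<exists>K>0. \<forall>n. 1 / gap n \<le> K * (deriv \<alpha> (node n) * \<langle>node n\<rangle>\<^sup>2)"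
proof -
  define B where "B = 1 + exp (C * (3 * pi)) * (3 * pi) / c"
  have B: "B > 0" using c(1) unfolding B_def by (intro add_pos_nonneg) auto
  have "1 / gap n \<le> (exp C * B\<^sup>2) * (deriv \<alpha> (node n) * \<langle>node n\<rangle>\<^sup>2)" for n
  proof -
    define x where "x = node n"
    define y where "y = node (n+1)"
    have xy: "x < y" unfolding x_def y_def using strict_mono_node by (simp add: strict_mono_def)
    have step: "\<alpha> y - \<alpha> x \<le> 3 * pi" "1 \<le> \<alpha> y - \<alpha> x"
      using level_step[of n] level_diff[of n "n+1"] pi_ge_two by (simp_all add: x_def y_def weight_node)
    obtain z where z: "x < z" "z < y" "arctan y - arctan x = (y - x) * inverse (1 + z\<^sup>2)"
      using MVT2[OF xy, of arctan "\<lambda>z. inverse (1 + z\<^sup>2)"] DERIV_arctan by blast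
    have "\<alpha> x < \<alpha> z" "\<alpha> z < \<alpha> y" using z by (simp_all add: weight_less_iff)
    then have d: "\<bar>\<alpha> z - \<alpha> x\<bar> \<le> 3 * pi" using step by linarith
    have "\<langle>z\<rangle> \<le> (1 + exp (C * \<bar>\<alpha> z - \<alpha> x\<bar>) * \<bar>\<alpha> z - \<alpha> x\<bar> / c) * \<langle>x\<rangle>" by (rule bracket_le)
    also have "\<dots> \<le> B * \<langle>x\<rangle>"
      unfolding B_def using d C(1) c(1) bracket_pos[of x]
      by (intro mult_right_mono add_left_mono divide_right_mono mult_mono) (auto intro: mult_left_mono)
    finally have "\<langle>z\<rangle>\<^sup>2 \<le> (B * \<langle>x\<rangle>)\<^sup>2" using bracket_pos[of z] by (intro power_mono) auto
    then have z2: "1 + z\<^sup>2 \<le> B\<^sup>2 * \<langle>x\<rangle>\<^sup>2" unfolding bracket_sq[of z] by (simp add: power_mult_distrib)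
    have z0: "1 + z\<^sup>2 > 0" by (simp add: add_pos_nonneg)
    have "exp (- C) / deriv \<alpha> x \<le> \<bar>y - x\<bar>" by (rule dist_ge_1) (use step in linarith)
    then have l: "exp (- C) / deriv \<alpha> x \<le> y - x" using xy by simp
    have "exp (- C) / deriv \<alpha> x * inverse (B\<^sup>2 * \<langle>x\<rangle>\<^sup>2) \<le> (y - x) * inverse (1 + z\<^sup>2)"
      using l z2 z0 xy B bracket_pos[of x] deriv_pos[of x]
      by (intro mult_mono le_imp_inverse_le) auto
    then have "exp (- C) / deriv \<alpha> x * inverse (B\<^sup>2 * \<langle>x\<rangle>\<^sup>2) \<le> gap n"
      unfolding z(3)[symmetric] by (simp add: gap_def x_def y_def)
    then have "1 / gap n \<le> 1 / (exp (- C) / deriv \<alpha> x * inverse (B\<^sup>2 * \<langle>x\<rangle>\<^sup>2))"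
      using B bracket_pos[of x] deriv_pos[of x] gap_pos[of n]
      by (intro divide_left_mono mult_pos_pos) auto
    also have "\<dots> = (exp C * B\<^sup>2) * (deriv \<alpha> x * \<langle>x\<rangle>\<^sup>2)" by (simp add: exp_minus divide_inverse)
    finally show ?thesis unfolding x_def .
  qed
  moreover have "exp C * B\<^sup>2 > 0" using B by simp
  ultimately show ?thesis by blast
qed

lemma norm_deriv_J_upper: "\<exists>K>0. \<exists>N::nat. N > 0 \<and> (\<forall>x. norm (deriv J (of_real x)) \<le> K * w x ^ N)"
proof -
  obtain K1 where K1: "K1 > 0" "\<And>n. 1 / gap n \<le> K1 * (deriv \<alpha> (node n) * \<langle>node n\<rangle>\<^sup>2)"
    using gap_lower by blast
  obtain K2 P where K2: "K2 > 0" "\<And>x. \<langle>x\<rangle> \<le> K2 * w x ^ P" using bracket_le_w by blast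
  define E where "E = exp (C * (2 * pi))"
  define B where "B = 1 + E * (2 * pi) / c"
  define K3 where "K3 = (1 + \<bar>offset\<bar>) / c + mass * exp C"
  define K4 where "K4 = 8 * K3\<^sup>2 * (K1 * E * B\<^sup>2) * K2"
  define K5 where "K5 = 16 * mass * (exp C)\<^sup>2"
  have E: "E > 0" by (simp add: E_def)
  have B: "B > 0" using c(1) E unfolding B_def by (intro add_pos_nonneg) auto
  have K3: "K3 \<ge> 0" using c(1) mass_nonneg by (simp add: K3_def)
  have K4: "K4 \<ge> 0" unfolding K4_def using K1(1) K2(1) E by simp
  have K5: "K5 \<ge> 0" unfolding K5_def using mass_nonneg by simp
  have main: "norm (deriv J (of_real x)) \<le> (K4 + K5 / c ^ (P + 1) + 1) * w x ^ (P + 3)" for x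
  proof -
    define d where "d = deriv \<alpha> x"
    have d: "d > 0" by (simp add: d_def deriv_pos)
    have wc: "c \<le> w x" by (rule w_lower)
    have w: "w x > 0" using wc c(1) by linarith
    have dw: "d \<le> w x" unfolding w_def d_def using bracket_ge_1[of x] deriv_pos[of x] by simp
    obtain n where n: "\<bar>\<alpha> x - \<alpha> (node n)\<bar> \<le> 2 * pi" "\<And>k. k \<noteq> n \<Longrightarrow> exp (- C) / d \<le> \<bar>node k - x\<bar>"
      unfolding d_def using nearest_node[of x] by blast
    have n': "\<bar>\<alpha> (node n) - \<alpha> x\<bar> \<le> 2 * pi" using n(1) by (simp add: abs_minus_commute)
    have Ele: "exp (C * \<bar>\<alpha> (node n) - \<alpha> x\<bar>) \<le> E"
      unfolding E_def using n' C(1) by (simp add: mult_left_mono)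
    have 1: "deriv \<alpha> (node n) \<le> E * d"
      using deriv_le_exp[of "node n" x] mult_right_mono[OF Ele, of d] d unfolding d_def by linarith
    have "\<langle>node n\<rangle> \<le> (1 + exp (C * \<bar>\<alpha> (node n) - \<alpha> x\<bar>) * \<bar>\<alpha> (node n) - \<alpha> x\<bar> / c) * \<langle>x\<rangle>"
      by (rule bracket_le)
    also have "\<dots> \<le> B * \<langle>x\<rangle>"
      unfolding B_def using n' Ele E c(1) bracket_pos[of x]
      by (intro mult_right_mono add_left_mono divide_right_mono mult_mono) auto
    finally have 2: "\<langle>node n\<rangle>\<^sup>2 \<le> (B * \<langle>x\<rangle>)\<^sup>2" using bracket_pos[of "node n"] by (intro power_mono) auto
    have "1 / gap n \<le> K1 * (deriv \<alpha> (node n) * \<langle>node n\<rangle>\<^sup>2)" by (rule K1(2))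
    also have "\<dots> \<le> K1 * ((E * d) * (B * \<langle>x\<rangle>)\<^sup>2)"
      using 1 2 K1(1) E d by (intro mult_left_mono mult_mono) auto
    also have "\<dots> = (K1 * E * B\<^sup>2) * (w x * \<langle>x\<rangle>)"
      by (simp add: w_def d_def power2_eq_square)
    also have "\<dots> \<le> (K1 * E * B\<^sup>2) * (w x * (K2 * w x ^ P))"
      using K1(1) E w K2(2)[of x] by (intro mult_left_mono) auto
    finally have g: "1 / gap n \<le> (K1 * E * B\<^sup>2) * (w x * (K2 * w x ^ P))" .
    have e0: "exp (- C) / d > 0" using d by simp
    have me: "mass / (exp (- C) / d) = mass * exp C * d" by (simp add: exp_minus divide_inverse)
    have "(1 + \<bar>offset\<bar>) * c \<le> (1 + \<bar>offset\<bar>) * w x" using wc by (intro mult_left_mono) auto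
    then have "1 + \<bar>offset\<bar> \<le> (1 + \<bar>offset\<bar>) / c * w x" using c(1) by (simp add: pos_le_divide_eq)
    moreover have "mass * exp C * d \<le> mass * exp C * w x"
      using dw mass_nonneg by (intro mult_left_mono) auto
    ultimately have Q: "1 + \<bar>offset\<bar> + mass / (exp (- C) / d) \<le> K3 * w x"
      unfolding me K3_def by (simp add: distrib_right)
    have Q0: "0 \<le> 1 + \<bar>offset\<bar> + mass / (exp (- C) / d)"
      using mass_nonneg d by (simp add: me)
    have "norm (deriv J (of_real x)) \<le> 8 * (1 + \<bar>offset\<bar> + mass / (exp (- C) / d))\<^sup>2 / gap n + 16 * mass / (exp (- C) / d)\<^sup>2"
      by (rule norm_deriv_J_le[OF e0 n(2)])
    also have "8 * (1 + \<bar>offset\<bar> + mass / (exp (- C) / d))\<^sup>2 / gap n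
       = 8 * (1 + \<bar>offset\<bar> + mass / (exp (- C) / d))\<^sup>2 * (1 / gap n)" by simp
    also have "\<dots> \<le> 8 * (K3 * w x)\<^sup>2 * ((K1 * E * B\<^sup>2) * (w x * (K2 * w x ^ P)))"
      using g Q Q0 gap_pos[of n] by (intro mult_mono mult_left_mono power_mono) auto
    also have "\<dots> = K4 * w x ^ (P + 3)"
      unfolding K4_def by (simp add: power_mult_distrib power_add power2_eq_square power3_eq_cube)
    also have "16 * mass / (exp (- C) / d)\<^sup>2 = K5 * d\<^sup>2"
      unfolding K5_def by (simp add: exp_minus divide_inverse power_mult_distrib power_inverse)
    also have "\<dots> \<le> K5 * (w x)\<^sup>2" using dw d K5 by (intro mult_left_mono power_mono) auto
    also have "\<dots> \<le> K5 * (w x ^ (P + 3) / c ^ (P + 1))"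
    proof (rule mult_left_mono[OF _ K5])
      have "(w x)\<^sup>2 * c ^ (P + 1) \<le> (w x)\<^sup>2 * w x ^ (P + 1)"
        using wc c(1) by (intro mult_left_mono power_mono) auto
      also have "\<dots> = w x ^ (P + 3)" by (simp add: power_add power2_eq_square power3_eq_cube mult_ac)
      finally show "(w x)\<^sup>2 \<le> w x ^ (P + 3) / c ^ (P + 1)" using c(1) by (simp add: pos_le_divide_eq)
    qed
    finally have "norm (deriv J (of_real x)) \<le> K4 * w x ^ (P + 3) + K5 * (w x ^ (P + 3) / c ^ (P + 1))"
      by simp
    then show ?thesis using zero_less_power[OF w, of "P + 3"] by (simp add: distrib_right)
  qed
  show ?thesis
  proof (intro exI conjI allI)
    show "K4 + K5 / c ^ (P + 1) + 1 > 0" using K4 K5 c(1) by (simp add: add_nonneg_pos)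
    show "P + 3 > 0" by simp
  qed (rule main)
qed

lemma between_nodes: "\<exists>n. level n \<le> \<alpha> x \<and> \<alpha> x < level (n+1)"
proof -
  define m where "m = \<lfloor>(\<alpha> x - 2 * pi * of_int k\<^sub>0) / (2 * pi)\<rfloor>"
  have "of_int m \<le> (\<alpha> x - 2 * pi * of_int k\<^sub>0) / (2 * pi)"
    "(\<alpha> x - 2 * pi * of_int k\<^sub>0) / (2 * pi) < of_int m + 1" unfolding m_def by linarith+
  then have m: "2 * pi * of_int (k\<^sub>0 + m) \<le> \<alpha> x" "\<alpha> x < 2 * pi * of_int (k\<^sub>0 + (m + 1))"
    by (simp_all add: field_simps)
  consider "m = 0" "\<alpha> x < \<alpha> 0" | "m = 0" "\<alpha> 0 \<le> \<alpha> x" | "m = -1" "\<alpha> 0 \<le> \<alpha> x"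
    | "m = -1" "\<alpha> x < \<alpha> 0" | "m \<noteq> 0" "m \<noteq> -1" by linarith
  then show ?thesis
  proof cases
    case 1
    then show ?thesis using m pi_gt_zero by (intro exI[of _ "-1"]) (auto simp: level_def algebra_simps)
  next
    case 2
    then show ?thesis using m by (intro exI[of _ 0]) (auto simp: level_def)
  next
    case 3
    then show ?thesis using m pi_gt_zero by (intro exI[of _ 0]) (auto simp: level_def algebra_simps)
  next
    case 4
    then show ?thesis using m by (intro exI[of _ "-1"]) (auto simp: level_def)
  next
    case 5
    then show ?thesis using m by (intro exI[of _ m]) (auto simp: level_def)
  qed
qed

lemma real_arg_J:
  shows "continuous_on UNIV (real_arg J)" "real_arg J 0 = 0" "J (of_real x) = cis (real_arg J x)"
proof -
  have "J 0 = 1" using J_node[of 0] by (simp add: node_0)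
  from theI'[OF ex1_real_arg[OF continuous_J_real norm_J_real this]]
  show "continuous_on UNIV (real_arg J)" "real_arg J 0 = 0" "J (of_real x) = cis (real_arg J x)"
    unfolding real_arg_def by blast+
qed

lemma real_arg_between:
  assumes "node n < x" "x < node (n+1)"
  shows "2 * pi * of_int n < real_arg J x" "real_arg J x < 2 * pi * of_int (n+1)"
proof -
  have "real_arg J (node n) = 2 * pi * of_int n"
    by (rule phase_node[OF real_arg_J(1,3)]) (simp add: node_0 real_arg_J(2))
  from phase_step(2)[OF real_arg_J(1,3) this, of x] assms
  show "2 * pi * of_int n < real_arg J x" "real_arg J x < 2 * pi * of_int (n+1)" by auto
qed

lemma sin_real_arg:
  assumes "node n < x" "x < node (n+1)"
  shows "sin (real_arg J x) = - 2 * f x / ((f x)\<^sup>2 + 1)"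
proof -
  have "x \<notin> range node"
    using assms strict_mono_node by (auto simp: strict_mono_less)
  then show ?thesis using J_real(2)[of x] real_arg_J(3)[of x] by simp
qed

lemma f_mono_between:
  assumes "node n < x" "x \<le> y" "y < node (n+1)"
  shows "f x \<le> f y"
proof (rule f_mono[OF assms(2)])
  fix k show "node k \<notin> {x..y}"
  proof
    assume "node k \<in> {x..y}"
    with assms have "node n < node k" "node k < node (n+1)" by auto
    then show False using strict_mono_node by (simp add: strict_mono_less)
  qed
qed

lemma arg_close: "\<bar>\<alpha> x - (real_arg J x + 2 * pi * of_int k\<^sub>0)\<bar> \<le> 2 * pi"
proof -
  define \<beta> where "\<beta> = \<alpha> x - 2 * pi * of_int k\<^sub>0"
  define \<phi> where "\<phi> = real_arg J x"
  define \<theta> where "\<theta> = \<alpha> 0 - 2 * pi * of_int k\<^sub>0"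
  have \<theta>: "\<bar>\<theta>\<bar> \<le> pi" using base by (simp add: \<theta>_def)
  have pi0: "pi > 0" by simp
  have pos1: "(f x)\<^sup>2 + 1 > 0" by (simp add: add_nonneg_pos)
  obtain n where n: "level n \<le> \<alpha> x" "\<alpha> x < level (n+1)" using between_nodes by blast
  have nx: "node n \<le> x" "x < node (n+1)"
    using n by (simp_all flip: weight_node add: weight_le_iff weight_less_iff)
  have "\<bar>\<beta> - \<phi>\<bar> \<le> 2 * pi"
  proof (cases "x = node n")
    case True
    have "\<phi> = 2 * pi * of_int n" unfolding \<phi>_def True
      by (rule phase_node[OF real_arg_J(1,3)]) (simp add: node_0 real_arg_J(2))
    moreover have "\<beta> = (if n = 0 then \<theta> else 2 * pi * of_int n)"
      unfolding \<beta>_def True weight_node by (simp add: level_def \<theta>_def algebra_simps)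
    ultimately show ?thesis using \<theta> pi0 by auto
  next
    case False
    with nx have x: "node n < x" "x < node (n+1)" by auto
    have \<phi>: "2 * pi * of_int n < \<phi>" "\<phi> < 2 * pi * of_int n + 2 * pi"
      using real_arg_between[OF x] by (simp_all add: \<phi>_def algebra_simps)
    have lo: "(if n = 0 then \<theta> else 2 * pi * of_int n) \<le> \<beta>"
      using n(1) by (auto simp: level_def \<beta>_def \<theta>_def algebra_simps)
    have hi: "\<beta> < (if n = -1 then \<theta> else 2 * pi * of_int n + 2 * pi)"
      using n(2) by (auto simp: level_def \<beta>_def \<theta>_def algebra_simps split: if_splits)
    consider "n = 0" "\<beta> < 0" | "n = -1" "\<beta> > 0" | "n = 0" "\<beta> \<ge> 0" | "n = -1" "\<beta> \<le> 0" | "n \<noteq> 0" "n \<noteq> -1"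
      by linarith
    then show ?thesis
    proof cases
      case 1
      have "\<alpha> x < \<alpha> centre" using 1(2) by (simp add: weight_centre \<beta>_def)
      then have "x < centre" by (simp add: weight_less_iff)
      moreover have "\<alpha> centre < \<alpha> (node 1)" using pi0 by (simp add: weight_centre weight_node level_def algebra_simps)
      then have "centre < node (n+1)" by (simp add: weight_less_iff 1)
      ultimately have "f x \<le> 0" using f_mono_between[OF x(1), of centre] f_centre by simp
      then have "sin \<phi> \<ge> 0" unfolding \<phi>_def sin_real_arg[OF x] using pos1 by (simp add: divide_le_0_iff)
      moreover have "sin \<phi> < 0" if "\<phi> > pi" using that \<phi> 1(1) by (intro sin_lt_zero) auto
      ultimately have "\<phi> \<le> pi" by fastforce
      then show ?thesis using 1 \<phi> lo \<theta> by simp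
    next
      case 2
      have "\<alpha> centre < \<alpha> x" using 2(2) by (simp add: weight_centre \<beta>_def)
      then have "centre < x" by (simp add: weight_less_iff)
      moreover have "\<alpha> (node (-1)) < \<alpha> centre" using pi0 by (simp add: weight_centre weight_node level_def algebra_simps)
      then have "node n < centre" by (simp add: weight_less_iff 2)
      ultimately have "f x \<ge> 0" using f_mono_between[of n centre x] x(2) f_centre by simp
      then have "sin \<phi> \<le> 0" unfolding \<phi>_def sin_real_arg[OF x] using pos1 by simp
      moreover have "sin (\<phi> + 2 * pi) > 0" if "\<phi> < - pi" using that \<phi> 2(1) by (intro sin_gt_zero) auto
      ultimately have "\<phi> \<ge> - pi" by (fastforce simp: not_less[symmetric])
      then show ?thesis using 2 \<phi> hi \<theta> by simp
    qed (use \<phi> lo hi \<theta> in auto)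
  qed
  then show ?thesis by (simp add: \<beta>_def \<phi>_def algebra_simps)
qed

lemma norm_deriv_J_lower:
  "\<exists>K>0. \<forall>l n. \<alpha> l = 2 * pi * of_int n \<longrightarrow> K \<le> norm (deriv J (of_real l))"
proof (intro exI conjI allI impI)
  let ?K = "min (2 / pi) (norm (deriv J (of_real centre)))"
  show "?K > 0" using deriv_J_nonzero by simp
  fix l n assume l: "\<alpha> l = 2 * pi * of_int n"
  show "?K \<le> norm (deriv J (of_real l))"
  proof (cases "n = k\<^sub>0")
    case True
    then have "\<alpha> l = \<alpha> centre" using l by (simp add: weight_centre)
    then have "l = centre" by (simp add: weight_eq_iff)
    then show ?thesis by simp
  next
    case False
    then have "\<alpha> l = \<alpha> (node (n - k\<^sub>0))" using l by (simp add: weight_node level_def)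
    then have "l = node (n - k\<^sub>0)" by (simp add: weight_eq_iff)
    then have "norm (deriv J (of_real l)) = 2 / gap (n - k\<^sub>0)" by (simp add: norm_deriv_J_node)
    moreover have "2 / pi \<le> 2 / gap (n - k\<^sub>0)"
      using gap_le_pi gap_pos by (intro divide_left_mono) auto
    ultimately show ?thesis by simp
  qed
qed

end

theorem theorem1:
  fixes \<alpha> :: "real \<Rightarrow> real" and \<kappa> :: real
  assumes "regular_locally_doubling_weight \<alpha>"
    and "\<kappa> < 1"
    and "lesssim_on UNIV (\<lambda>x. \<langle>x\<rangle> powr (-\<kappa>)) (deriv \<alpha>)"
  shows "\<exists>(J :: complex \<Rightarrow> complex) (N\<^sub>0 :: nat) (k :: int).
     meromorphic_inner_function J \<and> J 0 = 1 \<and> N\<^sub>0 > 0 \<and>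
     (\<bar>\<alpha> 0\<bar> \<le> pi \<longrightarrow> k = 0) \<and>
     (\<forall>x. \<bar>\<alpha> x - (real_arg J x + 2 * pi * of_int k)\<bar> \<le> 2 * pi) \<and>
     lesssim_on UNIV (\<lambda>x. norm (deriv J (of_real x))) (\<lambda>x. deriv \<alpha> x ^ N\<^sub>0 * \<langle>x\<rangle> ^ N\<^sub>0) \<and>
     lesssim_on {l. \<exists>n :: int. \<alpha> l = 2 * pi * of_int n}
       (\<lambda>l. \<langle>l\<rangle> powi (- int N\<^sub>0) * deriv \<alpha> l powi (- int N\<^sub>0)) (\<lambda>l. norm (deriv J (of_real l)))"
proof -
  obtain C c where "weight \<alpha> C c \<kappa>" by (rule regular_weightE[OF assms])
  then interpret weight \<alpha> C c \<kappa> .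
  define k :: int where "k = (if \<bar>\<alpha> 0\<bar> \<le> pi then 0 else round (\<alpha> 0 / (2 * pi)))"
  have k0: "\<bar>\<alpha> 0\<bar> \<le> pi \<longrightarrow> k = 0" by (simp add: k_def)
  have "\<bar>\<alpha> 0 - 2 * pi * of_int k\<bar> \<le> pi"
  proof (cases "\<bar>\<alpha> 0\<bar> \<le> pi")
    case False
    have "\<bar>of_int k - \<alpha> 0 / (2 * pi)\<bar> \<le> 1/2" using False of_int_round_abs_le by (simp add: k_def)
    then have "2 * pi * \<bar>of_int k - \<alpha> 0 / (2 * pi)\<bar> \<le> 2 * pi * (1/2)"
      by (intro mult_left_mono) auto
    moreover have "2 * pi * \<bar>of_int k - \<alpha> 0 / (2 * pi)\<bar> = \<bar>2 * pi * of_int k - \<alpha> 0\<bar>"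
      using abs_mult[of "2 * pi" "of_int k - \<alpha> 0 / (2 * pi)"] by (simp add: right_diff_distrib)
    ultimately show ?thesis by (simp add: abs_minus_commute)
  qed (simp add: k_def)
  then interpret shifted_weight \<alpha> C c \<kappa> k by unfold_locales
  obtain K N where KN: "K > 0" "N > 0" "\<And>x. norm (deriv J (of_real x)) \<le> K * w x ^ N"
    using norm_deriv_J_upper by blast
  obtain L where L: "L > 0" "\<And>l n. \<alpha> l = 2 * pi * of_int n \<Longrightarrow> L \<le> norm (deriv J (of_real l))"
    using norm_deriv_J_lower by blast
  have "lesssim_on UNIV (\<lambda>x. norm (deriv J (of_real x))) (\<lambda>x. deriv \<alpha> x ^ N * \<langle>x\<rangle> ^ N)"
    unfolding lesssim_on_def using KN(1,3)
    by (intro exI[of _ K]) (simp add: w_def power_mult_distrib)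
  moreover have "lesssim_on {l. \<exists>n :: int. \<alpha> l = 2 * pi * of_int n}
       (\<lambda>l. \<langle>l\<rangle> powi (- int N) * deriv \<alpha> l powi (- int N)) (\<lambda>l. norm (deriv J (of_real l)))"
    unfolding lesssim_on_def
  proof (intro exI conjI ballI)
    show "1 / (c ^ N * L) > 0" using c(1) L(1) by simp
    fix l assume "l \<in> {l. \<exists>n :: int. \<alpha> l = 2 * pi * of_int n}"
    then have "L \<le> norm (deriv J (of_real l))" using L(2) by blast
    then have "1 \<le> norm (deriv J (of_real l)) / L" using L(1) by simp
    moreover have "\<langle>l\<rangle> powi (- int N) * deriv \<alpha> l powi (- int N) = 1 / w l ^ N"
      by (simp add: w_def power_int_minus power_mult_distrib divide_inverse mult.commute)
    moreover have "1 / w l ^ N \<le> 1 / c ^ N"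
      using w_lower[of l] c(1) by (intro divide_left_mono power_mono) (auto intro!: mult_pos_pos zero_less_power)
    moreover have "1 / c ^ N * 1 \<le> 1 / c ^ N * (norm (deriv J (of_real l)) / L)"
      using calculation(1) c(1) by (intro mult_left_mono) auto
    ultimately show "\<langle>l\<rangle> powi (- int N) * deriv \<alpha> l powi (- int N) \<le> 1 / (c ^ N * L) * norm (deriv J (of_real l))"
      by simp
  qed
  moreover have "J 0 = 1" using J_node[of 0] by (simp add: node_0)
  ultimately show ?thesis
    using meromorphic_inner_J KN(2) k0 arg_close
    by (intro exI[of _ J] exI[of _ N] exI[of _ k] conjI allI) simp_all
qed

end
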